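(* Let $\eta\in L^\infty_+(\Omega)$. The sequence $\{\mathbf j_n\}_{n\in\mathbb{N}}$ of the maximizers of the problems $$\tau_n(\eta)=\max\{\langle A\mathbf j,\mathbf j\rangle : \mathbf j\in H_L^n(\Omega),\ \|\mathbf j\|_\eta=1\},\qquad n=1,2,\dots,$$ forms a complete basis in $H_L(\Omega)$.
   Context: $\Omega\subset\mathbb{R}^3$ is an open bounded domain with Lipschitz boundary and outer unit normal $\hat{\mathbf n}$. $\langle \mathbf u,\mathbf v\rangle=\int_\Omega \mathbf u\cdot\mathbf v\,\mathrm dV$ is the $L^2(\Omega;\mathbb{R}^3)$ inner product. $L^\infty_+(\Omega)$ is the set of $\theta\in L^\infty(\Omega)$ such that $\theta\ge c_0$ a.e. in $\Omega$ for some constant $c_0>0$. $H_L(\Omega)$ is the space of $\mathbf v\in L^2(\Omega;\mathbb{R}^3)$ with $\operatorname{div}\mathbf v=0$ in $\Omega$ and $\mathbf v\cdot\hat{\mathbf n}=0$ on $\partial\Omega$ (normal trace in the weak sense). The operator $A:H_L(\Omega)\to L^2(\Omega;\mathbb{R}^3)$ is $(A\mathbf v)(x)=\frac{\mu_0}{4\pi}\int_\Omega\frac{\mathbf v(x')}{\|x-x'\|}\,\mathrm dV(x')$ with $\mu_0>0$ a constant; it is compact, self-adjoint and positive definite. For $\eta\in L^\infty_+(\Omega)$ put $\|\mathbf v\|_\eta=\sqrt{\langle \eta\mathbf v,\mathbf v\rangle}$. The spaces and maximizers are defined inductively: $H_L^1(\Omega)=H_L(\Omega)$, $H_L^n(\Omega)=\{\mathbf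 v\in H_L(\Omega): \langle \mathbf v,\eta\mathbf j_1\rangle=\dots=\langle\mathbf v,\eta\mathbf j_{n-1}\rangle=0\}$ for $n\ge2$, and $\mathbf j_n\in H_L^n(\Omega)$ with $\|\mathbf j_n\|_\eta=1$ is a chosen maximizer at step $n$. "Complete basis in $H_L(\Omega)$" means that the $\mathbf j_n$, which are orthonormal for the inner product $\langle\eta\,\cdot,\cdot\rangle$, have linear span dense in $H_L(\Omega)$ (for the $L^2$ norm, equivalently the norm $\|\cdot\|_\eta$), so that every element of $H_L(\Omega)$ is the sum of its Fourier series in $\{\mathbf j_n\}$. *)

theory Defs
  imports "HOL-Analysis.Analysis"
begin

section \<open>Bounded Lipschitz domains\<close>

text \<open>
  Near every boundary point, and in suitable Cartesian coordinates (given by the orthogonal map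
  \<open>T\<close>), the set is the strict epigraph of a Lipschitz function of the first two coordinates.
  The metric on \<open>real \<times> real\<close> is the Euclidean one.
\<close>
definition lipschitz_boundary :: "(real^3) set \<Rightarrow> bool" where
  "lipschitz_boundary \<Omega> \<longleftrightarrow>
     (\<forall>p \<in> frontier \<Omega>. \<exists>r>0. \<exists>(T :: real^3 \<Rightarrow> real^3) (\<gamma> :: real \<times> real \<Rightarrow> real) L.
        orthogonal_transformation T \<and> L-lipschitz_on UNIV \<gamma> \<and>
        \<Omega> \<inter> ball p r = {x \<in> ball p r. T x $ 3 > \<gamma> (T x $ 1, T x $ 2)})"

definition bounded_lipschitz_domain :: "(real^3) set \<Rightarrow> bool" where
  "bounded_lipschitz_domain \<Omega> \<longleftrightarrow>
     open \<Omega> \<and> connected \<Omega> \<and> \<Omega> \<noteq> {} \<and> bounded \<Omega> \<and> lipschitz_boundary \<Omega>"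


section \<open>Lebesgue spaces\<close>

text \<open>
  Elements of Lebesgue spaces are represented by functions on the whole space, of which only the
  restriction to \<open>\<Omega>\<close>, up to null sets, matters. So \<open>l2_norm \<Omega>\<close> is a
  seminorm on representatives.
\<close>
definition L2 :: "(real^3) set \<Rightarrow> (real^3 \<Rightarrow> 'b::euclidean_space) set" where
  "L2 \<Omega> = {v. v \<in> borel_measurable (lebesgue_on \<Omega>) \<and>
               integrable (lebesgue_on \<Omega>) (\<lambda>x. (norm (v x))\<^sup>2)}"

definition l2_inner :: "(real^3) set \<Rightarrow> (real^3 \<Rightarrow> 'b::euclidean_space) \<Rightarrow> (real^3 \<Rightarrow> 'b) \<Rightarrow> real" where
  "l2_inner \<Omega> u v = (LINT x | lebesgue_on \<Omega>. u x \<bullet> v x)"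

definition l2_norm :: "(real^3) set \<Rightarrow> (real^3 \<Rightarrow> 'b::euclidean_space) \<Rightarrow> real" where
  "l2_norm \<Omega> v = sqrt (l2_inner \<Omega> v v)"

definition Linf_plus :: "(real^3) set \<Rightarrow> (real^3 \<Rightarrow> real) set" where
  "Linf_plus \<Omega> = {\<theta>. \<theta> \<in> borel_measurable (lebesgue_on \<Omega>) \<and>
                     (\<exists>C. AE x in lebesgue_on \<Omega>. \<bar>\<theta> x\<bar> \<le> C) \<and>
                     (\<exists>c\<^sub>0>0. AE x in lebesgue_on \<Omega>. \<theta> x \<ge> c\<^sub>0)}"

definition weighted :: "(real^3 \<Rightarrow> real) \<Rightarrow> (real^3 \<Rightarrow> real^3) \<Rightarrow> real^3 \<Rightarrow> real^3" where
  "weighted \<eta> v = (\<lambda>x. \<eta> x *\<^sub>R v x)"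

definition eta_norm :: "(real^3) set \<Rightarrow> (real^3 \<Rightarrow> real) \<Rightarrow> (real^3 \<Rightarrow> real^3) \<Rightarrow> real" where
  "eta_norm \<Omega> \<eta> v = sqrt (l2_inner \<Omega> (weighted \<eta> v) v)"


section \<open>Weak derivatives and the space \<open>H\<^sub>L\<close>\<close>

text \<open>Functions on the whole space that are \<open>k\<close> times continuously differentiable.\<close>
primrec Ck :: "nat \<Rightarrow> (real^3 \<Rightarrow> real) \<Rightarrow> bool" where
  "Ck 0 f \<longleftrightarrow> continuous_on UNIV f"
| "Ck (Suc k) f \<longleftrightarrow> (\<exists>g. (\<forall>x. GDERIV f x :> g x) \<and> (\<forall>i. Ck k (\<lambda>x. g x $ i)))"

definition test_function :: "(real^3) set \<Rightarrow> (real^3 \<Rightarrow> real) \<Rightarrow> bool" where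
  "test_function \<Omega> \<psi> \<longleftrightarrow>
     (\<forall>k. Ck k \<psi>) \<and> compact (closure {x. \<psi> x \<noteq> 0}) \<and> closure {x. \<psi> x \<noteq> 0} \<subseteq> \<Omega>"

definition gradient :: "(real^3 \<Rightarrow> real) \<Rightarrow> real^3 \<Rightarrow> real^3" where
  "gradient f x = (THE D. GDERIV f x :> D)"

definition has_weak_div :: "(real^3) set \<Rightarrow> (real^3 \<Rightarrow> real^3) \<Rightarrow> (real^3 \<Rightarrow> real) \<Rightarrow> bool" where
  "has_weak_div \<Omega> v d \<longleftrightarrow>
     (\<forall>\<psi>. test_function \<Omega> \<psi> \<longrightarrow> l2_inner \<Omega> v (gradient \<psi>) = - l2_inner \<Omega> d \<psi>)"

definition has_weak_grad :: "(real^3) set \<Rightarrow> (real^3 \<Rightarrow> real) \<Rightarrow> (real^3 \<Rightarrow> real^3) \<Rightarrow> bool" where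
  "has_weak_grad \<Omega> \<phi> g \<longleftrightarrow>
     (\<forall>\<psi>. test_function \<Omega> \<psi> \<longrightarrow>
        (LINT x | lebesgue_on \<Omega>. \<phi> x *\<^sub>R gradient \<psi> x) = - (LINT x | lebesgue_on \<Omega>. \<psi> x *\<^sub>R g x))"

text \<open>
  For a field \<open>v\<close> with weak divergence \<open>d\<close>, both square integrable, the normal trace
  is the functional on traces of Sobolev functions given by Green's formula,
  \<open>\<phi> \<mapsto> \<integral> v \<bullet> \<nabla>\<phi> + \<integral> d \<phi>\<close>
  for \<open>\<phi>\<close> in \<open>H\<^sup>1(\<Omega>)\<close>. The pairs \<open>(\<phi>, g)\<close> below are exactly the
  elements of \<open>H\<^sup>1(\<Omega>)\<close> with their weak gradients.
\<close>
definition zero_normal_trace :: "(real^3) set \<Rightarrow> (real^3 \<Rightarrow> real^3) \<Rightarrow> (real^3 \<Rightarrow> real) \<Rightarrow> bool" where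
  "zero_normal_trace \<Omega> v d \<longleftrightarrow>
     (\<forall>\<phi> \<in> L2 \<Omega>. \<forall>g \<in> L2 \<Omega>. has_weak_grad \<Omega> \<phi> g \<longrightarrow>
        l2_inner \<Omega> v g + l2_inner \<Omega> d \<phi> = 0)"

definition HL :: "(real^3) set \<Rightarrow> (real^3 \<Rightarrow> real^3) set" where
  "HL \<Omega> = {v \<in> L2 \<Omega>. has_weak_div \<Omega> v (\<lambda>_. 0) \<and> zero_normal_trace \<Omega> v (\<lambda>_. 0)}"


section \<open>The operator and the maximization problems\<close>

text \<open>At \<open>x' = x\<close> the kernel takes the value \<open>1 / 0 = 0\<close>, on a null set.\<close>
definition A_op :: "real \<Rightarrow> (real^3) set \<Rightarrow> (real^3 \<Rightarrow> real^3) \<Rightarrow> real^3 \<Rightarrow> real^3" where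
  "A_op \<mu>\<^sub>0 \<Omega> v x =
     (\<mu>\<^sub>0 / (4 * pi)) *\<^sub>R (LINT x' | lebesgue_on \<Omega>. (1 / norm (x - x')) *\<^sub>R v x')"

text \<open>Sequences are indexed from 1; the value of \<open>j\<close> at 0 is irrelevant throughout.\<close>
definition HLn :: "(real^3) set \<Rightarrow> (real^3 \<Rightarrow> real) \<Rightarrow> (nat \<Rightarrow> real^3 \<Rightarrow> real^3) \<Rightarrow> nat
                     \<Rightarrow> (real^3 \<Rightarrow> real^3) set" where
  "HLn \<Omega> \<eta> j n = {v \<in> HL \<Omega>. \<forall>k\<in>{1..<n}. l2_inner \<Omega> v (weighted \<eta> (j k)) = 0}"

definition maximizer_sequence ::
  "real \<Rightarrow> (real^3) set \<Rightarrow> (real^3 \<Rightarrow> real) \<Rightarrow> (nat \<Rightarrow> real^3 \<Rightarrow> real^3) \<Rightarrow> bool" where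
  "maximizer_sequence \<mu>\<^sub>0 \<Omega> \<eta> j \<longleftrightarrow>
     (\<forall>n\<ge>1. is_arg_max (\<lambda>v. l2_inner \<Omega> (A_op \<mu>\<^sub>0 \<Omega> v) v)
                       (\<lambda>v. v \<in> HLn \<Omega> \<eta> j n \<and> eta_norm \<Omega> \<eta> v = 1) (j n))"

text \<open>
  Orthonormality for the weighted inner product, density of the linear span, and convergence of
  all Fourier series. The norms of \<open>L\<^sup>2\<close> and of the weighted inner product are equivalent.
\<close>
definition complete_basis_HL ::
  "(real^3) set \<Rightarrow> (real^3 \<Rightarrow> real) \<Rightarrow> (nat \<Rightarrow> real^3 \<Rightarrow> real^3) \<Rightarrow> bool" where
  "complete_basis_HL \<Omega> \<eta> j \<longleftrightarrow>
     (\<forall>n\<ge>1. j n \<in> HL \<Omega>) \<and>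
     (\<forall>m\<ge>1. \<forall>n\<ge>1. l2_inner \<Omega> (weighted \<eta> (j m)) (j n) = (if m = n then 1 else 0)) \<and>
     (\<forall>v\<in>HL \<Omega>. \<forall>\<epsilon>>0. \<exists>N c. l2_norm \<Omega> (\<lambda>x. v x - (\<Sum>k=1..N. c k *\<^sub>R j k x)) < \<epsilon>) \<and>
     (\<forall>v\<in>HL \<Omega>. (\<lambda>N. l2_norm \<Omega> (\<lambda>x. v x -
          (\<Sum>k=1..N. l2_inner \<Omega> (weighted \<eta> v) (j k) *\<^sub>R j k x))) \<longlonglongrightarrow> 0)"

end

theory Submission
  imports Defs "HOL-Probability.Distributions"
begin

text \<open>
  Subtract from \<open>v\<close> its \<open>N\<close>-th Fourier sum. The residual \<open>r\<^sub>N\<close> is admissible up to scaling in the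
  problem number \<open>N + 1\<close>, so its energy \<open>\<langle>A r\<^sub>N, r\<^sub>N\<rangle>\<close> is at most \<open>\<tau>\<^sub>N\<^sub>+\<^sub>1\<close> times its squared
  weighted norm. Bessel's inequality, applied to the rows of the square integrable kernel of \<open>A\<close>, gives
  \<open>\<parallel>A j\<^sub>n\<parallel> \<longrightarrow> 0\<close> and hence \<open>\<tau>\<^sub>n \<longrightarrow> 0\<close>. The residuals form a Cauchy sequence; their limit in
  \<open>L\<^sup>2\<close> has energy at most 0, and it vanishes because \<open>A\<close> is positive definite on all of \<open>L\<^sup>2\<close>.
\<close>

section \<open>The space of square integrable functions\<close>

text \<open>The kernel 1 / norm (x - y) has an integrable square because the dimension is three:
  near the pole, volumes of balls shrink like the cube of the radius while the squared kernel grows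
  only like its inverse square. The resulting bound is uniform in x. The main obstacle is positive
  definiteness. The limit of the residuals is known only as a square integrable field, so the
  property has to come from the integral alone. Up to a constant factor, 1 / d is the integral of
  the Gaussians exp (- t^2 d^2) over t. A Gaussian in x - y is a factor in x times a factor in y
  times exp (2 t^2 (x . y)), whose power series has positive coefficients, and expanding a power of
  x . y in coordinates turns its energy into a sum of squared moments. Vanishing energy makes every
  polynomial moment vanish, and Weierstrass approximation then forces the field to be zero almost
  everywhere. The weight enters through two devices: coercivity compares the two norms, and division
  by \<eta> turns a plain inner product into a weighted one.\<close>

lemma L2_measurable: "v \<in> L2 \<Omega> \<Longrightarrow> v \<in> borel_measurable (lebesgue_on \<Omega>)"
  by (simp add: L2_def)

lemma L2_integrable_norm_sq: "v \<in> L2 \<Omega> \<Longrightarrow> integrable (lebesgue_on \<Omega>) (\<lambda>x. (norm (v x))\<^sup>2)"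
  by (simp add: L2_def)

lemma L2_bound:
  assumes "u \<in> L2 \<Omega>" "v \<in> borel_measurable (lebesgue_on \<Omega>)"
    and "AE x in lebesgue_on \<Omega>. norm (v x) \<le> C * norm (u x)"
  shows "v \<in> L2 \<Omega>"
proof -
  have "integrable (lebesgue_on \<Omega>) (\<lambda>x. C\<^sup>2 * (norm (u x))\<^sup>2)"
    using L2_integrable_norm_sq[OF assms(1)] by simp
  then have "integrable (lebesgue_on \<Omega>) (\<lambda>x. (norm (v x))\<^sup>2)"
  proof (rule Bochner_Integration.integrable_bound)
    show "AE x in lebesgue_on \<Omega>. norm ((norm (v x))\<^sup>2) \<le> norm (C\<^sup>2 * (norm (u x))\<^sup>2)"
      using assms(3)
    proof eventually_elim
      case (elim x)
      then have "(norm (v x))\<^sup>2 \<le> (C * norm (u x))\<^sup>2" by (intro power_mono) auto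
      then show ?case by (simp add: power_mult_distrib)
    qed
  qed (use assms(2) in measurable)
  with assms(2) show ?thesis by (simp add: L2_def)
qed

lemma L2_scaleR: "v \<in> L2 \<Omega> \<Longrightarrow> (\<lambda>x. c *\<^sub>R v x) \<in> L2 \<Omega>"
  by (rule L2_bound[where u = v and C = "\<bar>c\<bar>"]) (auto dest: L2_measurable)

lemma L2_norm: "v \<in> L2 \<Omega> \<Longrightarrow> (\<lambda>x. norm (v x)) \<in> L2 \<Omega>"
  by (rule L2_bound[where u = v and C = 1]) (auto dest: L2_measurable)

lemma L2_add:
  assumes "u \<in> L2 \<Omega>" "v \<in> L2 \<Omega>"
  shows "(\<lambda>x. u x + v x) \<in> L2 \<Omega>"
proof -
  note [measurable] = assms[THEN L2_measurable]
  have "integrable (lebesgue_on \<Omega>) (\<lambda>x. 2 * (norm (u x))\<^sup>2 + 2 * (norm (v x))\<^sup>2)"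
    using assms by (intro Bochner_Integration.integrable_add) (auto dest: L2_integrable_norm_sq)
  then have "integrable (lebesgue_on \<Omega>) (\<lambda>x. (norm (u x + v x))\<^sup>2)"
  proof (rule Bochner_Integration.integrable_bound)
    have "(norm (a + b))\<^sup>2 \<le> 2 * (norm a)\<^sup>2 + 2 * (norm b)\<^sup>2" for a b :: 'a
    proof -
      have "(norm (a + b))\<^sup>2 \<le> (norm a + norm b)\<^sup>2"
        by (intro power_mono norm_triangle_ineq norm_ge_zero)
      also have "\<dots> \<le> 2 * (norm a)\<^sup>2 + 2 * (norm b)\<^sup>2"
        using sum_squares_bound[of "norm a" "norm b"] by (simp add: power2_sum)
      finally show ?thesis .
    qed
    then show "AE x in lebesgue_on \<Omega>. norm ((norm (u x + v x))\<^sup>2) \<le> norm (2 * (norm (u x))\<^sup>2 + 2 * (norm (v x))\<^sup>2)"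
      by simp
  qed simp
  then show ?thesis by (simp add: L2_def)
qed

lemma L2_diff: "u \<in> L2 \<Omega> \<Longrightarrow> v \<in> L2 \<Omega> \<Longrightarrow> (\<lambda>x. u x - v x) \<in> L2 \<Omega>"
  using L2_add[of u \<Omega> "\<lambda>x. (-1) *\<^sub>R v x"] L2_scaleR[of v \<Omega> "-1"] by simp

lemma L2_zero: "(\<lambda>x. 0) \<in> L2 \<Omega>"
  by (simp add: L2_def)

lemma L2_sum: "(\<And>k. k \<in> I \<Longrightarrow> f k \<in> L2 \<Omega>) \<Longrightarrow> (\<lambda>x. \<Sum>k\<in>I. f k x) \<in> L2 \<Omega>"
  by (induction I rule: infinite_finite_induct) (auto intro: L2_zero L2_add)

lemma L2_integrable_norm_mult:
  fixes u :: "real^3 \<Rightarrow> 'a::euclidean_space" and v :: "real^3 \<Rightarrow> 'b::euclidean_space"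
  assumes "u \<in> L2 \<Omega>" "v \<in> L2 \<Omega>"
  shows "integrable (lebesgue_on \<Omega>) (\<lambda>x. norm (u x) * norm (v x))"
proof -
  note [measurable] = assms[THEN L2_measurable]
  have "integrable (lebesgue_on \<Omega>) (\<lambda>x. (norm (u x))\<^sup>2 + (norm (v x))\<^sup>2)"
    using assms by (intro Bochner_Integration.integrable_add) (auto dest: L2_integrable_norm_sq)
  then show ?thesis
  proof (rule Bochner_Integration.integrable_bound)
    have "a * b \<le> a\<^sup>2 + b\<^sup>2" if "a \<ge> 0" "b \<ge> 0" for a b :: real
      using sum_squares_bound[of a b] mult_nonneg_nonneg[OF that] by linarith
    then show "AE x in lebesgue_on \<Omega>. norm (norm (u x) * norm (v x)) \<le> norm ((norm (u x))\<^sup>2 + (norm (v x))\<^sup>2)"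
      by simp
  qed simp
qed

lemma L2_integrable_inner:
  assumes "u \<in> L2 \<Omega>" "v \<in> L2 \<Omega>"
  shows "integrable (lebesgue_on \<Omega>) (\<lambda>x. u x \<bullet> v x)"
proof (rule Bochner_Integration.integrable_bound[OF L2_integrable_norm_mult[OF assms]])
  note [measurable] = assms[THEN L2_measurable]
  show "(\<lambda>x. u x \<bullet> v x) \<in> borel_measurable (lebesgue_on \<Omega>)" by simp
qed (simp add: Cauchy_Schwarz_ineq2)

lemma L2_integrable_scaleR:
  fixes f :: "real^3 \<Rightarrow> real" and v :: "real^3 \<Rightarrow> 'a::euclidean_space"
  assumes "f \<in> L2 \<Omega>" "v \<in> L2 \<Omega>"
  shows "integrable (lebesgue_on \<Omega>) (\<lambda>x. f x *\<^sub>R v x)"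
proof (rule Bochner_Integration.integrable_bound[OF L2_integrable_norm_mult[OF assms]])
  note [measurable] = assms[THEN L2_measurable]
  show "(\<lambda>x. f x *\<^sub>R v x) \<in> borel_measurable (lebesgue_on \<Omega>)" by simp
qed simp

lemma L2_const:
  assumes "\<Omega> \<in> lmeasurable"
  shows "(\<lambda>x. c) \<in> L2 \<Omega>"
proof -
  interpret finite_measure "lebesgue_on \<Omega>"
    using assms by (rule finite_measure_lebesgue_on)
  show ?thesis by (simp add: L2_def)
qed

lemma L2_bounded:
  assumes "\<Omega> \<in> lmeasurable" "v \<in> borel_measurable (lebesgue_on \<Omega>)" "\<And>x. x \<in> \<Omega> \<Longrightarrow> norm (v x) \<le> C"
  shows "v \<in> L2 \<Omega>"
  by (rule L2_bound[OF L2_const[OF assms(1), of "1::real"] assms(2), of C])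
     (use assms(3) in \<open>auto intro!: AE_I2\<close>)

lemma L2_integrable:
  assumes "\<Omega> \<in> lmeasurable" "v \<in> L2 \<Omega>"
  shows "integrable (lebesgue_on \<Omega>) v"
  using L2_integrable_scaleR[OF L2_const[OF assms(1), of 1] assms(2)] by simp

lemma l2_inner_commute: "l2_inner \<Omega> u v = l2_inner \<Omega> v u"
  by (simp add: l2_inner_def inner_commute)

lemma l2_inner_cong_AE:
  assumes "u \<in> borel_measurable (lebesgue_on \<Omega>)" "u' \<in> borel_measurable (lebesgue_on \<Omega>)"
    "v \<in> borel_measurable (lebesgue_on \<Omega>)" "AE x in lebesgue_on \<Omega>. u x = u' x"
  shows "l2_inner \<Omega> u v = l2_inner \<Omega> u' v"
  unfolding l2_inner_def using assms by (intro integral_cong_AE) auto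

lemma l2_inner_add_left:
  "u \<in> L2 \<Omega> \<Longrightarrow> v \<in> L2 \<Omega> \<Longrightarrow> w \<in> L2 \<Omega> \<Longrightarrow> l2_inner \<Omega> (\<lambda>x. u x + v x) w = l2_inner \<Omega> u w + l2_inner \<Omega> v w"
  by (simp add: l2_inner_def inner_add_left L2_integrable_inner)

lemma l2_inner_add_right:
  "u \<in> L2 \<Omega> \<Longrightarrow> v \<in> L2 \<Omega> \<Longrightarrow> w \<in> L2 \<Omega> \<Longrightarrow> l2_inner \<Omega> w (\<lambda>x. u x + v x) = l2_inner \<Omega> w u + l2_inner \<Omega> w v"
  by (simp add: l2_inner_def inner_add_right L2_integrable_inner)

lemma l2_inner_diff_left:
  "u \<in> L2 \<Omega> \<Longrightarrow> v \<in> L2 \<Omega> \<Longrightarrow> w \<in> L2 \<Omega> \<Longrightarrow> l2_inner \<Omega> (\<lambda>x. u x - v x) w = l2_inner \<Omega> u w - l2_inner \<Omega> v w"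
  by (simp add: l2_inner_def inner_diff_left L2_integrable_inner)

lemma l2_inner_diff_right:
  "u \<in> L2 \<Omega> \<Longrightarrow> v \<in> L2 \<Omega> \<Longrightarrow> w \<in> L2 \<Omega> \<Longrightarrow> l2_inner \<Omega> w (\<lambda>x. u x - v x) = l2_inner \<Omega> w u - l2_inner \<Omega> w v"
  by (simp add: l2_inner_def inner_diff_right L2_integrable_inner)

lemma l2_inner_scaleR_left: "l2_inner \<Omega> (\<lambda>x. c *\<^sub>R u x) v = c * l2_inner \<Omega> u v"
  by (simp add: l2_inner_def)

lemma l2_inner_scaleR_right: "l2_inner \<Omega> u (\<lambda>x. c *\<^sub>R v x) = c * l2_inner \<Omega> u v"
  by (simp add: l2_inner_def)

lemma l2_inner_zero_left: "l2_inner \<Omega> (\<lambda>x. 0) v = 0"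
  by (simp add: l2_inner_def)

lemma l2_inner_sum_left:
  "(\<And>k. k \<in> I \<Longrightarrow> f k \<in> L2 \<Omega>) \<Longrightarrow> v \<in> L2 \<Omega> \<Longrightarrow> 
    l2_inner \<Omega> (\<lambda>x. \<Sum>k\<in>I. f k x) v = (\<Sum>k\<in>I. l2_inner \<Omega> (f k) v)"
  unfolding l2_inner_def inner_sum_left
  by (rule Bochner_Integration.integral_sum) (auto intro: L2_integrable_inner)

lemma l2_inner_self_nonneg: "l2_inner \<Omega> v v \<ge> 0"
  by (simp add: l2_inner_def)

lemma l2_norm_nonneg: "l2_norm \<Omega> v \<ge> 0"
  by (simp add: l2_norm_def l2_inner_self_nonneg)

lemma l2_norm_sq: "(l2_norm \<Omega> v)\<^sup>2 = l2_inner \<Omega> v v"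
  by (simp add: l2_norm_def l2_inner_self_nonneg)

lemma l2_norm_norm: "l2_norm \<Omega> (\<lambda>x. norm (v x)) = l2_norm \<Omega> v"
  by (simp add: l2_norm_def l2_inner_def dot_square_norm power2_eq_square)

lemma l2_norm_scaleR: "l2_norm \<Omega> (\<lambda>x. c *\<^sub>R v x) = \<bar>c\<bar> * l2_norm \<Omega> v"
  by (simp add: l2_norm_def l2_inner_scaleR_left l2_inner_scaleR_right real_sqrt_mult)

lemma l2_norm_minus_commute: "l2_norm \<Omega> (\<lambda>x. u x - v x) = l2_norm \<Omega> (\<lambda>x. v x - u x)"
  using l2_norm_scaleR[of \<Omega> "-1" "\<lambda>x. u x - v x"] by simp

lemma nonneg_quadratic_imp_discriminant:
  fixes a b c :: real
  assumes q: "\<And>t. 0 \<le> a * t\<^sup>2 + 2 * b * t + c" and "a \<ge> 0"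
  shows "b\<^sup>2 \<le> a * c"
proof (cases "a = 0")
  case True
  have "b = 0"
  proof (rule ccontr)
    assume "b \<noteq> 0"
    \<comment> \<open>For \<open>a = 0\<close> the form is affine in \<open>t\<close>, and at this
      point it equals -1.\<close>
    then show False using q[of "- (c + 1) / (2 * b)"] True by (simp add: field_simps)
  qed
  with True show ?thesis by simp
next
  case False
  \<comment> \<open>The minimizer of the quadratic is - b / a; the extra factor \<open>a\<close>
    clears the denominator.\<close>
  have "0 \<le> a * (a * (- b / a)\<^sup>2 + 2 * b * (- b / a) + c)"
    by (intro mult_nonneg_nonneg q \<open>a \<ge> 0\<close>)
  also have "\<dots> = a * c - b\<^sup>2"
    using False by (simp add: field_simps power2_eq_square)
  finally show ?thesis by simp
qed

lemma l2_Cauchy_Schwarz: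
  assumes "u \<in> L2 \<Omega>" "v \<in> L2 \<Omega>"
  shows "\<bar>l2_inner \<Omega> u v\<bar> \<le> l2_norm \<Omega> u * l2_norm \<Omega> v"
proof -
  have "0 \<le> l2_inner \<Omega> u u * t\<^sup>2 + 2 * l2_inner \<Omega> u v * t + l2_inner \<Omega> v v" for t
  proof -
    let ?w = "\<lambda>x. t *\<^sub>R u x + v x"
    have w: "?w \<in> L2 \<Omega>" and tu: "(\<lambda>x. t *\<^sub>R u x) \<in> L2 \<Omega>"
      using assms by (auto intro: L2_add L2_scaleR)
    have "0 \<le> l2_inner \<Omega> ?w ?w" by (rule l2_inner_self_nonneg)
    also have "\<dots> = t * (t * l2_inner \<Omega> u u + l2_inner \<Omega> v u) + (t * l2_inner \<Omega> u v + l2_inner \<Omega> v v)"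
      by (simp add: l2_inner_add_left[OF tu assms(2) w] l2_inner_add_right[OF tu assms(2)] assms
          l2_inner_scaleR_left l2_inner_scaleR_right l2_inner_commute[of _ v u])
    finally show ?thesis
      by (simp add: algebra_simps power2_eq_square l2_inner_commute[of _ v u])
  qed
  then have "(l2_inner \<Omega> u v)\<^sup>2 \<le> l2_inner \<Omega> u u * l2_inner \<Omega> v v"
    by (intro nonneg_quadratic_imp_discriminant l2_inner_self_nonneg)
  then have "(l2_inner \<Omega> u v)\<^sup>2 \<le> (l2_norm \<Omega> u * l2_norm \<Omega> v)\<^sup>2"
    by (simp add: power_mult_distrib l2_norm_sq)
  then show ?thesis
    using l2_norm_nonneg[of \<Omega> u] l2_norm_nonneg[of \<Omega> v] by (metis abs_le_square_iff abs_of_nonneg mult_nonneg_nonneg)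
qed

lemma l2_norm_triangle:
  assumes "u \<in> L2 \<Omega>" "v \<in> L2 \<Omega>"
  shows "l2_norm \<Omega> (\<lambda>x. u x + v x) \<le> l2_norm \<Omega> u + l2_norm \<Omega> v"
proof (rule power2_le_imp_le)
  have w: "(\<lambda>x. u x + v x) \<in> L2 \<Omega>" by (rule L2_add[OF assms])
  have "l2_inner \<Omega> (\<lambda>x. u x + v x) (\<lambda>x. u x + v x) = l2_inner \<Omega> u u + 2 * l2_inner \<Omega> u v + l2_inner \<Omega> v v"
    by (simp add: l2_inner_add_left[OF assms w] l2_inner_add_right[OF assms] assms
        l2_inner_commute[of _ v u])
  also have "\<dots> \<le> (l2_norm \<Omega> u + l2_norm \<Omega> v)\<^sup>2"
    using l2_Cauchy_Schwarz[OF assms] by (simp add: power2_sum l2_norm_sq)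
  finally show "(l2_norm \<Omega> (\<lambda>x. u x + v x))\<^sup>2 \<le> (l2_norm \<Omega> u + l2_norm \<Omega> v)\<^sup>2"
    by (simp add: l2_norm_sq)
qed (simp add: l2_norm_nonneg)

text \<open>Cauchy-Schwarz against the constant 1. On a set of finite measure this turns Cauchy
  sequences in the mean square into Cauchy sequences in the mean.\<close>

lemma integral_norm_le_l2_norm:
  assumes "\<Omega> \<in> lmeasurable" "v \<in> L2 \<Omega>"
  shows "(LINT x|lebesgue_on \<Omega>. norm (v x)) \<le> sqrt (measure lebesgue \<Omega>) * l2_norm \<Omega> v"
proof -
  have "\<bar>l2_inner \<Omega> (\<lambda>x. 1::real) (\<lambda>x. norm (v x))\<bar> \<le> l2_norm \<Omega> (\<lambda>x. 1::real) * l2_norm \<Omega> (\<lambda>x. norm (v x))"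
    by (intro l2_Cauchy_Schwarz L2_const L2_norm assms)
  moreover have "l2_norm \<Omega> (\<lambda>x. 1::real) = sqrt (measure lebesgue \<Omega>)"
    using assms(1) by (simp add: l2_norm_def l2_inner_def measure_restrict_space fmeasurableD)
  ultimately show ?thesis
    by (simp add: l2_norm_norm) (simp add: l2_inner_def)
qed

text \<open>Riesz-Fischer. A sequence that is Cauchy in the mean has a subsequence converging almost
  everywhere, and Fatou's lemma along this subsequence bounds the mean square distance to the
  pointwise limit.\<close>

lemma L2_complete:
  fixes s :: "nat \<Rightarrow> real^3 \<Rightarrow> 'b::euclidean_space"
  assumes \<Omega>: "\<Omega> \<in> lmeasurable" and s: "\<And>n. s n \<in> L2 \<Omega>"
    and Cauchy: "\<And>e. e > 0 \<Longrightarrow> \<exists>N. \<forall>i\<ge>N. \<forall>j\<ge>N. l2_norm \<Omega> (\<lambda>x. s i x - s j x) < e"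
  obtains r where "r \<in> L2 \<Omega>" "(\<lambda>n. l2_norm \<Omega> (\<lambda>x. s n x - r x)) \<longlonglongrightarrow> 0"
proof -
  let ?M = "lebesgue_on \<Omega>"
  note [measurable] = s[THEN L2_measurable]
  have "\<exists>N. \<forall>i\<ge>N. \<forall>j\<ge>N. (LINT x|?M. norm (s i x - s j x)) < e" if "e > 0" for e
  proof -
    \<comment> \<open>Adding 1 keeps the divisor positive even if the set has measure zero.\<close>
    define m where "m = sqrt (measure lebesgue \<Omega>) + 1"
    have "m > 0" by (simp add: m_def add_nonneg_pos)
    then obtain N where N: "\<forall>i\<ge>N. \<forall>j\<ge>N. l2_norm \<Omega> (\<lambda>x. s i x - s j x) < e / m"
      using Cauchy[of "e / m"] \<open>e > 0\<close> by auto
    have "(LINT x|?M. norm (s i x - s j x)) < e" if "i \<ge> N" "j \<ge> N" for i j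
    proof -
      have "(LINT x|?M. norm (s i x - s j x)) \<le> sqrt (measure lebesgue \<Omega>) * l2_norm \<Omega> (\<lambda>x. s i x - s j x)"
        by (intro integral_norm_le_l2_norm \<Omega> L2_diff s)
      also have "\<dots> \<le> m * l2_norm \<Omega> (\<lambda>x. s i x - s j x)"
        by (intro mult_right_mono l2_norm_nonneg) (simp add: m_def)
      also have "\<dots> < m * (e / m)"
        using N that \<open>m > 0\<close> by (intro mult_strict_left_mono) auto
      finally show ?thesis using \<open>m > 0\<close> by simp
    qed
    then show ?thesis by blast
  qed
  then obtain k where k: "strict_mono k" "AE x in ?M. Cauchy (\<lambda>i. s (k i) x)"
    using cauchy_L1_AE_cauchy_subseq[where M = ?M and s = s, OF L2_integrable[OF \<Omega> s]] by blast
  define r where "r = (\<lambda>x. lim (\<lambda>i. s (k i) x))"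
  have [measurable]: "r \<in> borel_measurable ?M"
    unfolding r_def by measurable
  have lim: "AE x in ?M. (\<lambda>i. s (k i) x) \<longlonglongrightarrow> r x"
    using k(2) unfolding r_def
    by eventually_elim (blast dest: Cauchy_convergent convergent_LIMSEQ_iff[THEN iffD1])
  \<comment> \<open>Stated for the difference because \<open>r\<close> is not yet known to be square
    integrable; that follows from this estimate and the integrability of a single
    \<open>s N\<close>.\<close>
  have est: "(\<lambda>x. s n x - r x) \<in> L2 \<Omega> \<and> l2_norm \<Omega> (\<lambda>x. s n x - r x) \<le> e"
    if "e > 0" and N: "\<forall>i\<ge>N. \<forall>j\<ge>N. l2_norm \<Omega> (\<lambda>x. s i x - s j x) < e" and "n \<ge> N" for e n N
  proof -
    have "(\<integral>\<^sup>+x. ennreal ((norm (s n x - r x))\<^sup>2) \<partial>?M)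
        = (\<integral>\<^sup>+x. liminf (\<lambda>i. ennreal ((norm (s n x - s (k i) x))\<^sup>2)) \<partial>?M)"
    proof (rule nn_integral_cong_AE)
      show "AE x in ?M. ennreal ((norm (s n x - r x))\<^sup>2) = liminf (\<lambda>i. ennreal ((norm (s n x - s (k i) x))\<^sup>2))"
        using lim
      proof eventually_elim
        case (elim x)
        then have "(\<lambda>i. ennreal ((norm (s n x - s (k i) x))\<^sup>2)) \<longlonglongrightarrow> ennreal ((norm (s n x - r x))\<^sup>2)"
          by (intro tendsto_intros)
        then show ?case by (metis lim_imp_Liminf sequentially_bot)
      qed
    qed
    also have "\<dots> \<le> liminf (\<lambda>i. \<integral>\<^sup>+x. ennreal ((norm (s n x - s (k i) x))\<^sup>2) \<partial>?M)"
      by (rule nn_integral_liminf) simp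
    also have "\<dots> \<le> liminf (\<lambda>i. ennreal (e\<^sup>2))"
    proof (rule Liminf_mono)
      have "(\<integral>\<^sup>+x. ennreal ((norm (s n x - s (k i) x))\<^sup>2) \<partial>?M) \<le> ennreal (e\<^sup>2)" if "i \<ge> N" for i
      proof -
        have "k i \<ge> N" using that seq_suble[OF k(1), of i] by simp
        have "(\<integral>\<^sup>+x. ennreal ((norm (s n x - s (k i) x))\<^sup>2) \<partial>?M) = ennreal (LINT x|?M. (norm (s n x - s (k i) x))\<^sup>2)"
          by (intro nn_integral_eq_integral L2_integrable_norm_sq L2_diff s) auto
        also have "\<dots> = ennreal ((l2_norm \<Omega> (\<lambda>x. s n x - s (k i) x))\<^sup>2)"
          by (simp only: l2_norm_sq) (simp add: l2_inner_def dot_square_norm)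
        also have "\<dots> \<le> ennreal (e\<^sup>2)"
          using N \<open>n \<ge> N\<close> \<open>k i \<ge> N\<close> by (intro ennreal_leI power_mono l2_norm_nonneg less_imp_le) blast
        finally show ?thesis .
      qed
      then show "\<forall>\<^sub>F i in sequentially. (\<integral>\<^sup>+x. ennreal ((norm (s n x - s (k i) x))\<^sup>2) \<partial>?M) \<le> ennreal (e\<^sup>2)"
        by (rule eventually_sequentiallyI)
    qed
    finally have le: "(\<integral>\<^sup>+x. ennreal ((norm (s n x - r x))\<^sup>2) \<partial>?M) \<le> ennreal (e\<^sup>2)"
      by (simp add: Liminf_const)
    have "integrable ?M (\<lambda>x. (norm (s n x - r x))\<^sup>2)"
      by (rule integrableI_bounded) (use order_le_less_trans[OF le] in auto)
    then have L: "(\<lambda>x. s n x - r x) \<in> L2 \<Omega>" by (simp add: L2_def)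
    have "ennreal ((l2_norm \<Omega> (\<lambda>x. s n x - r x))\<^sup>2) = (\<integral>\<^sup>+x. ennreal ((norm (s n x - r x))\<^sup>2) \<partial>?M)"
      by (subst nn_integral_eq_integral[OF L2_integrable_norm_sq[OF L]])
         (auto simp: l2_norm_sq l2_inner_def dot_square_norm)
    with le have "ennreal ((l2_norm \<Omega> (\<lambda>x. s n x - r x))\<^sup>2) \<le> ennreal (e\<^sup>2)"
      by (simp only:)
    then have "(l2_norm \<Omega> (\<lambda>x. s n x - r x))\<^sup>2 \<le> e\<^sup>2" by simp
    with L show ?thesis
      using power2_le_imp_le[of "l2_norm \<Omega> (\<lambda>x. s n x - r x)" e] \<open>e > 0\<close> by simp
  qed
  show thesis
  proof
    obtain N where N: "\<forall>i\<ge>N. \<forall>j\<ge>N. l2_norm \<Omega> (\<lambda>x. s i x - s j x) < 1"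
      using Cauchy[of 1] by auto
    have "(\<lambda>x. s N x - r x) \<in> L2 \<Omega>"
      using est[OF _ N, of N] by simp
    from L2_diff[OF s[of N] this] show "r \<in> L2 \<Omega>" by simp
    show "(\<lambda>n. l2_norm \<Omega> (\<lambda>x. s n x - r x)) \<longlonglongrightarrow> 0"
    proof (rule LIMSEQ_I)
      fix e :: real assume "e > 0"
      \<comment> \<open>Fatou's lemma weakens the strict bound to a non-strict one, so half of
        \<open>e\<close> is used.\<close>
      then obtain N where N: "\<forall>i\<ge>N. \<forall>j\<ge>N. l2_norm \<Omega> (\<lambda>x. s i x - s j x) < e / 2"
        using Cauchy[of "e / 2"] by auto
      show "\<exists>N. \<forall>n\<ge>N. norm (l2_norm \<Omega> (\<lambda>x. s n x - r x) - 0) < e"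
      proof (intro exI allI impI)
        fix n assume "n \<ge> N"
        with est[OF _ N, of n] \<open>e > 0\<close> show "norm (l2_norm \<Omega> (\<lambda>x. s n x - r x) - 0) < e"
          by (simp add: l2_norm_nonneg)
      qed
    qed
  qed
qed

section \<open>The Newtonian kernel\<close>

lemma ident_borel_measurable_lebesgue_on [measurable]:
  "(\<lambda>x::'a::euclidean_space. x) \<in> borel_measurable (lebesgue_on \<Omega>)"
  by (intro measurable_restrict_space1 measurable_completion) simp

lemma ennreal_le_suminf:
  fixes f :: "nat \<Rightarrow> ennreal"
  shows "f k \<le> (\<Sum>i. f i)"
  using sum_le_suminf[of f "{k}"] by simp

text \<open>Dyadic decomposition around \<open>x\<close>. On the shell between radii D / 2^(k+1) and
  D / 2^k the integrand is at most 4^(k+1) / D^2, and the outer ball has volume (D / 2^k)^3 times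
  that of the unit ball. Term k is thus a multiple of (1/2)^k, and the geometric series gives the
  factor 8.\<close>

lemma nn_integral_inverse_square_le:
  fixes x :: "real^3"
  assumes "\<Omega> \<in> sets lebesgue" and D: "D > 0" "\<And>y. y \<in> \<Omega> \<Longrightarrow> norm (x - y) < D"
  shows "(\<integral>\<^sup>+y. ennreal (1 / (norm (x - y))\<^sup>2) \<partial>lebesgue_on \<Omega>) \<le> ennreal (8 * D * measure lborel (ball (0::real^3) 1))"
proof -
  let ?V = "measure lborel (ball (0::real^3) 1)"
  have "(\<integral>\<^sup>+y. ennreal (1 / (norm (x - y))\<^sup>2) \<partial>lebesgue_on \<Omega>)
    = (\<integral>\<^sup>+y. ennreal (1 / (norm (x - y))\<^sup>2) * indicator \<Omega> y \<partial>lebesgue)"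
    using assms(1) by (simp add: nn_integral_restrict_space)
  also have "\<dots> \<le> (\<integral>\<^sup>+y. (\<Sum>k. ennreal (4 ^ Suc k / D\<^sup>2) * indicator (ball x (D / 2 ^ k)) y) \<partial>lebesgue)"
  proof (rule nn_integral_mono)
    fix y
    show "ennreal (1 / (norm (x - y))\<^sup>2) * indicator \<Omega> y
       \<le> (\<Sum>k. ennreal (4 ^ Suc k / D\<^sup>2) * indicator (ball x (D / 2 ^ k)) y)"
    proof (cases "y \<in> \<Omega> \<and> y \<noteq> x")
      case False
      \<comment> \<open>At the pole the integrand is 1 / 0 = 0; outside the set the indicator
        vanishes.\<close>
      then show ?thesis by (cases "y = x") auto
    next
      case True
      define d where "d = norm (x - y)"
      have d: "0 < d" "d < D" using True D(2) by (auto simp: d_def)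
      obtain n where "(1/2::real) ^ n < d / D"
        using real_arch_pow_inv[of "d / D" "1/2"] d D(1) by auto
      then have ex: "\<exists>n. D / 2 ^ n \<le> d"
        using D(1) by (intro exI[of _ n]) (simp add: field_simps)
      \<comment> \<open>The first dyadic radius not exceeding \<open>d\<close> is not
        \<open>D\<close> itself, since \<open>d < D\<close>. Its predecessor, by minimality, exceeds
        \<open>d\<close> and so identifies the shell containing \<open>y\<close>.\<close>
      define m where "m = (LEAST n. D / 2 ^ n \<le> d)"
      have m: "D / 2 ^ m \<le> d" unfolding m_def by (rule LeastI_ex[OF ex])
      with d have "m \<noteq> 0" by (intro notI) simp
      then obtain k where k: "m = Suc k" using not0_implies_Suc by blast
      then have "\<not> D / 2 ^ k \<le> d" using not_less_Least[of k "\<lambda>n. D / 2 ^ n \<le> d"] by (simp add: m_def)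
      then have ind: "y \<in> ball x (D / 2 ^ k)" by (simp add: d_def dist_norm)
      have "(D / 2 ^ Suc k)\<^sup>2 \<le> d\<^sup>2" using m k D(1) by (intro power_mono) auto
      then have "D\<^sup>2 \<le> d\<^sup>2 * 4 ^ Suc k"
        using D(1) by (simp add: power_divide field_simps power2_eq_square flip: power_mult_distrib)
      then have "1 / d\<^sup>2 \<le> 4 ^ Suc k / D\<^sup>2"
        using d D(1) by (simp add: field_simps)
      then have "ennreal (1 / d\<^sup>2) * indicator \<Omega> y \<le> ennreal (4 ^ Suc k / D\<^sup>2) * indicator (ball x (D / 2 ^ k)) y"
        using ind True by (simp add: ennreal_leI)
      also have "\<dots> \<le> (\<Sum>k. ennreal (4 ^ Suc k / D\<^sup>2) * indicator (ball x (D / 2 ^ k)) y)"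
        by (rule ennreal_le_suminf)
      finally show ?thesis by (simp add: d_def)
    qed
  qed
  also have "\<dots> = (\<Sum>k. \<integral>\<^sup>+y. ennreal (4 ^ Suc k / D\<^sup>2) * indicator (ball x (D / 2 ^ k)) y \<partial>lebesgue)"
    by (rule nn_integral_suminf)
       (intro borel_measurable_times_ennreal borel_measurable_const borel_measurable_indicator, simp)
  also have "\<dots> = (\<Sum>k. ennreal (4 * D * ?V * (1/2) ^ k))"
  proof (rule suminf_cong)
    fix k :: nat
    \<comment> \<open>Common powers of 2, so that 4^k from the kernel cancels against 8^k from the
      volume and leaves (1/2)^k.\<close>
    have e8: "(8::real) ^ k = 2 ^ k * (2 ^ k * 2 ^ k)" "(4::real) ^ k = 2 ^ k * 2 ^ k"
      by (simp_all flip: power_mult_distrib)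
    have "(\<integral>\<^sup>+y. ennreal (4 ^ Suc k / D\<^sup>2) * indicator (ball x (D / 2 ^ k)) y \<partial>lebesgue)
      = ennreal (4 ^ Suc k / D\<^sup>2) * emeasure lebesgue (ball x (D / 2 ^ k))"
      by (rule nn_integral_cmult_indicator) simp
    also have "emeasure lebesgue (ball x (D / 2 ^ k)) = ennreal (measure lborel (ball x (D / 2 ^ k)))"
      using emeasure_lborel_ball_finite[of x "D / 2 ^ k"] by (subst emeasure_eq_ennreal_measure) auto
    also have "measure lborel (ball x (D / 2 ^ k)) = (D / 2 ^ k) ^ 3 * ?V"
      using D(1) by (subst content_ball_conv_unit_ball) auto
    also have "ennreal (4 ^ Suc k / D\<^sup>2) * ennreal ((D / 2 ^ k) ^ 3 * ?V) = ennreal (4 ^ Suc k / D\<^sup>2 * ((D / 2 ^ k) ^ 3 * ?V))"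
      by (rule ennreal_mult[symmetric]) (use D(1) in auto)
    also have "4 ^ Suc k / D\<^sup>2 * ((D / 2 ^ k) ^ 3 * ?V) = 4 * D * ?V * (1/2) ^ k"
      using D(1) by (simp add: e8 power_divide power2_eq_square power3_eq_cube)
    finally show "(\<integral>\<^sup>+y. ennreal (4 ^ Suc k / D\<^sup>2) * indicator (ball x (D / 2 ^ k)) y \<partial>lebesgue)
      = ennreal (4 * D * ?V * (1/2) ^ k)" .
  qed
  also have "\<dots> = ennreal (4 * D * ?V * 2)"
  proof (rule suminf_ennreal_eq)
    show "(\<lambda>k. 4 * D * ?V * (1/2) ^ k) sums (4 * D * ?V * 2)"
      using sums_mult[OF geometric_sums[of "1/2::real"], of "4 * D * ?V"] by simp
  qed (use D(1) in auto)
  finally show ?thesis by (simp add: mult_ac)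
qed

lemma newton_kernel_L2:
  assumes \<Omega>: "\<Omega> \<in> sets lebesgue" "bounded \<Omega>"
  obtains C where "C \<ge> 0" "\<And>x. x \<in> \<Omega> \<Longrightarrow> (\<lambda>y. 1 / norm (x - y)) \<in> L2 \<Omega>"
    "\<And>x. x \<in> \<Omega> \<Longrightarrow> l2_norm \<Omega> (\<lambda>y. 1 / norm (x - y)) \<le> C"
proof -
  obtain B where B: "\<And>x. x \<in> \<Omega> \<Longrightarrow> norm x < B" "B > 0"
    using \<Omega>(2) unfolding bounded_pos_less by blast
  \<comment> \<open>Any two points of the set are at distance less than 2 B. This constant bounds
    the square of the norm, hence \<open>sqrt C\<close> below.\<close>
  define C where "C = 8 * (2 * B) * measure lborel (ball (0::real^3) 1)"
  have "C \<ge> 0" using B(2) by (simp add: C_def)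
  have *: "(\<lambda>y. 1 / norm (x - y)) \<in> L2 \<Omega> \<and> l2_norm \<Omega> (\<lambda>y. 1 / norm (x - y)) \<le> sqrt C" if x: "x \<in> \<Omega>" for x
  proof -
    have "norm (x - y) < 2 * B" if "y \<in> \<Omega>" for y
      using norm_triangle_ineq4[of x y] B(1)[OF x] B(1)[OF that] by simp
    then have le: "(\<integral>\<^sup>+y. ennreal (1 / (norm (x - y))\<^sup>2) \<partial>lebesgue_on \<Omega>) \<le> ennreal C"
      unfolding C_def using B(2) by (intro nn_integral_inverse_square_le \<Omega>) auto
    have m: "(\<lambda>y. 1 / norm (x - y)) \<in> borel_measurable (lebesgue_on \<Omega>)"
      by simp
    have "integrable (lebesgue_on \<Omega>) (\<lambda>y. (norm (1 / norm (x - y)))\<^sup>2)"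
    proof (rule integrableI_bounded)
      show "(\<lambda>y. (norm (1 / norm (x - y)))\<^sup>2) \<in> borel_measurable (lebesgue_on \<Omega>)"
        using m by simp
      show "(\<integral>\<^sup>+y. ennreal (norm ((norm (1 / norm (x - y)))\<^sup>2)) \<partial>lebesgue_on \<Omega>) < \<infinity>"
        using order_le_less_trans[OF le ennreal_less_top] by (simp add: power_divide)
    qed
    with m have L: "(\<lambda>y. 1 / norm (x - y)) \<in> L2 \<Omega>" by (simp only: L2_def mem_Collect_eq)
    have "ennreal ((l2_norm \<Omega> (\<lambda>y. 1 / norm (x - y)))\<^sup>2) = ennreal (LINT y|lebesgue_on \<Omega>. (norm (1 / norm (x - y)))\<^sup>2)"
      by (simp only: l2_norm_sq l2_inner_def dot_square_norm)
    also have "\<dots> = (\<integral>\<^sup>+y. ennreal ((norm (1 / norm (x - y)))\<^sup>2) \<partial>lebesgue_on \<Omega>)"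
      by (rule nn_integral_eq_integral[symmetric, OF L2_integrable_norm_sq[OF L]]) (rule AE_I2, simp)
    also have "\<dots> \<le> ennreal C" using le by (simp add: power_divide)
    finally have "(l2_norm \<Omega> (\<lambda>y. 1 / norm (x - y)))\<^sup>2 \<le> C" using \<open>C \<ge> 0\<close> by simp
    with L show ?thesis
      by (simp add: real_le_rsqrt)
  qed
  show thesis
    by (rule that[of "sqrt C"]) (use * \<open>C \<ge> 0\<close> in simp_all)
qed


section \<open>The operator\<close>

lemma A_op_integrable:
  "(\<lambda>y. 1 / norm (x - y)) \<in> L2 \<Omega> \<Longrightarrow> v \<in> L2 \<Omega> \<Longrightarrow>
    integrable (lebesgue_on \<Omega>) (\<lambda>y. (1 / norm (x - y)) *\<^sub>R v y)"
  by (rule L2_integrable_scaleR)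

text \<open>Splitting the integral requires both parts to be integrable, which is known when
  \<open>x\<close> lies in the domain. The identity is therefore pointwise and enters inner products
  through \<open>l2_inner_cong\<close>.\<close>

lemma A_op_diff:
  assumes "(\<lambda>y. 1 / norm (x - y)) \<in> L2 \<Omega>" "u \<in> L2 \<Omega>" "v \<in> L2 \<Omega>"
  shows "A_op \<mu> \<Omega> (\<lambda>y. u y - v y) x = A_op \<mu> \<Omega> u x - A_op \<mu> \<Omega> v x"
  unfolding A_op_def scaleR_diff_right
  by (subst Bochner_Integration.integral_diff[OF A_op_integrable A_op_integrable])
     (use assms in \<open>auto simp: scaleR_diff_right\<close>)

lemma A_op_scaleR: "A_op \<mu> \<Omega> (\<lambda>y. c *\<^sub>R v y) x = c *\<^sub>R A_op \<mu> \<Omega> v x"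
  by (simp only: A_op_def scaleR_left_commute[of _ c] integral_scaleR_right)

lemma A_op_measurable:
  assumes "\<Omega> \<in> lmeasurable" "v \<in> L2 \<Omega>"
  shows "A_op \<mu> \<Omega> v \<in> borel_measurable (lebesgue_on \<Omega>)"
proof -
  interpret finite_measure "lebesgue_on \<Omega>"
    using assms(1) by (rule finite_measure_lebesgue_on)
  note [measurable] = L2_measurable[OF assms(2)]
  have "(\<lambda>x. LINT y|lebesgue_on \<Omega>. (1 / norm (x - y)) *\<^sub>R v y) \<in> borel_measurable (lebesgue_on \<Omega>)"
    by (rule borel_measurable_lebesgue_integral) measurable
  then show ?thesis by (simp add: A_op_def[abs_def])
qed

lemma norm_A_op_le:
  assumes K: "(\<lambda>y. 1 / norm (x - y)) \<in> L2 \<Omega>" and v: "v \<in> L2 \<Omega>" and "\<mu> > 0"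
  shows "norm (A_op \<mu> \<Omega> v x) \<le> \<mu> / (4 * pi) * (l2_norm \<Omega> (\<lambda>y. 1 / norm (x - y)) * l2_norm \<Omega> v)"
proof -
  have "norm (LINT y|lebesgue_on \<Omega>. (1 / norm (x - y)) *\<^sub>R v y)
     \<le> (LINT y|lebesgue_on \<Omega>. norm ((1 / norm (x - y)) *\<^sub>R v y))"
    by (rule integral_norm_bound)
  also have "\<dots> = l2_inner \<Omega> (\<lambda>y. 1 / norm (x - y)) (\<lambda>y. norm (v y))"
    by (simp add: l2_inner_def)
  also have "\<dots> \<le> l2_norm \<Omega> (\<lambda>y. 1 / norm (x - y)) * l2_norm \<Omega> v"
    using l2_Cauchy_Schwarz[OF K L2_norm[OF v]] by (simp only: l2_norm_norm)
  finally have "\<mu> / (4 * pi) * norm (LINT y|lebesgue_on \<Omega>. (1 / norm (x - y)) *\<^sub>R v y)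
    \<le> \<mu> / (4 * pi) * (l2_norm \<Omega> (\<lambda>y. 1 / norm (x - y)) * l2_norm \<Omega> v)"
    using \<open>\<mu> > 0\<close> by (intro mult_left_mono) auto
  then show ?thesis using \<open>\<mu> > 0\<close> by (simp add: A_op_def)
qed

text \<open>Cauchy-Schwarz on each row of the kernel bounds the image pointwise by \<open>D\<close>
  times the norm of \<open>v\<close>; finite measure turns this uniform bound into a mean square
  bound.\<close>

lemma A_op_bounded:
  assumes \<Omega>: "\<Omega> \<in> lmeasurable" "bounded \<Omega>" and "\<mu> > 0"
  obtains C where "C \<ge> 0" "\<And>v. v \<in> L2 \<Omega> \<Longrightarrow> A_op \<mu> \<Omega> v \<in> L2 \<Omega>"
    "\<And>v. v \<in> L2 \<Omega> \<Longrightarrow> l2_norm \<Omega> (A_op \<mu> \<Omega> v) \<le> C * l2_norm \<Omega> v"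
proof -
  obtain B where B: "B \<ge> 0" "\<And>x. x \<in> \<Omega> \<Longrightarrow> (\<lambda>y. 1 / norm (x - y)) \<in> L2 \<Omega>"
    "\<And>x. x \<in> \<Omega> \<Longrightarrow> l2_norm \<Omega> (\<lambda>y. 1 / norm (x - y)) \<le> B"
    using newton_kernel_L2[OF fmeasurableD[OF \<Omega>(1)] \<Omega>(2)] by blast
  define D where "D = \<mu> / (4 * pi) * B"
  have "D \<ge> 0" using B(1) \<open>\<mu> > 0\<close> by (simp add: D_def)
  have le: "norm (A_op \<mu> \<Omega> v x) \<le> D * l2_norm \<Omega> v" if "v \<in> L2 \<Omega>" "x \<in> \<Omega>" for v x
  proof -
    have "norm (A_op \<mu> \<Omega> v x) \<le> \<mu> / (4 * pi) * (l2_norm \<Omega> (\<lambda>y. 1 / norm (x - y)) * l2_norm \<Omega> v)"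
      by (intro norm_A_op_le B that \<open>\<mu> > 0\<close>)
    also have "\<dots> \<le> \<mu> / (4 * pi) * (B * l2_norm \<Omega> v)"
      using \<open>\<mu> > 0\<close> that by (intro mult_left_mono mult_right_mono B l2_norm_nonneg) auto
    finally show ?thesis by (simp add: D_def)
  qed
  have A: "A_op \<mu> \<Omega> v \<in> L2 \<Omega>" if "v \<in> L2 \<Omega>" for v
    using le[OF that] by (intro L2_bounded \<Omega> A_op_measurable that)
  define m where "m = sqrt (measure lebesgue \<Omega>)"
  have "l2_norm \<Omega> (A_op \<mu> \<Omega> v) \<le> (D * m) * l2_norm \<Omega> v" if v: "v \<in> L2 \<Omega>" for v
  proof (rule power2_le_imp_le)
    interpret finite_measure "lebesgue_on \<Omega>"
      using \<Omega>(1) by (rule finite_measure_lebesgue_on)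
    have "(l2_norm \<Omega> (A_op \<mu> \<Omega> v))\<^sup>2 = (LINT x|lebesgue_on \<Omega>. (norm (A_op \<mu> \<Omega> v x))\<^sup>2)"
      by (simp only: l2_norm_sq l2_inner_def dot_square_norm)
    also have "\<dots> \<le> (LINT x|lebesgue_on \<Omega>. (D * l2_norm \<Omega> v)\<^sup>2)"
      by (intro integral_mono L2_integrable_norm_sq A v power_mono le) auto
    also have "\<dots> = ((D * m) * l2_norm \<Omega> v)\<^sup>2"
      using \<Omega>(1) by (simp add: m_def power_mult_distrib measure_restrict_space fmeasurableD)
    finally show "(l2_norm \<Omega> (A_op \<mu> \<Omega> v))\<^sup>2 \<le> ((D * m) * l2_norm \<Omega> v)\<^sup>2" .
  qed (use \<open>D \<ge> 0\<close> in \<open>simp add: m_def l2_norm_nonneg\<close>)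
  with A show thesis
    using \<open>D \<ge> 0\<close> by (intro that[of "D * m"]) (auto simp: m_def)
qed

lemma A_op_L2:
  assumes "\<Omega> \<in> lmeasurable" "bounded \<Omega>" "\<mu> > 0" "v \<in> L2 \<Omega>"
  shows "A_op \<mu> \<Omega> v \<in> L2 \<Omega>"
  by (rule A_op_bounded[OF assms(1-3)]) (use assms(4) in simp)

section \<open>Positive definiteness\<close>

text \<open>The polynomial functions, generated by multiplying with one coordinate at a time. This
  shape matches \<open>power_form_Suc\<close>, which also moves a single coordinate factor, so that
  induction over polynomials can follow that recursion.\<close>

inductive monomial_span :: "('a::euclidean_space \<Rightarrow> real) \<Rightarrow> bool" where
  const: "monomial_span (\<lambda>x. c)"
| add: "monomial_span p \<Longrightarrow> monomial_span q \<Longrightarrow> monomial_span (\<lambda>x. p x + q x)"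
| coord: "b \<in> Basis \<Longrightarrow> monomial_span p \<Longrightarrow> monomial_span (\<lambda>x. (x \<bullet> b) * p x)"

lemma monomial_span_continuous: "monomial_span p \<Longrightarrow> continuous_on S p"
  by (induction rule: monomial_span.induct) (auto intro!: continuous_intros)

lemma monomial_span_cmult: "monomial_span p \<Longrightarrow> monomial_span (\<lambda>x. c * p x)"
proof (induction rule: monomial_span.induct)
  case (const d)
  show ?case by (rule monomial_span.const)
next
  case (add p q)
  then show ?case by (simp add: distrib_left monomial_span.add)
next
  case (coord b p)
  then show ?case by (simp add: mult.left_commute[of c] monomial_span.coord)
qed

lemma monomial_span_mult:
  assumes "monomial_span p" "monomial_span q"
  shows "monomial_span (\<lambda>x. p x * q x)"
  using assms(1)
proof (induction rule: monomial_span.induct)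
  case (const c)
  show ?case by (rule monomial_span_cmult[OF assms(2)])
next
  case (add p p')
  then show ?case by (simp add: distrib_right monomial_span.add)
next
  case (coord b p)
  then show ?case by (simp add: mult.assoc monomial_span.coord)
qed

lemma monomial_span_dense:
  fixes f :: "'a::euclidean_space \<Rightarrow> real"
  assumes "compact S" "continuous_on S f" "e > 0"
  obtains p where "monomial_span p" "\<And>x. x \<in> S \<Longrightarrow> \<bar>f x - p x\<bar> < e"
proof -
  have "\<exists>p. monomial_span p \<and> (\<forall>x\<in>S. \<bar>f x - p x\<bar> < e)"
  proof (rule Stone_Weierstrass_HOL[OF assms(1) _ _ _ _ _ assms(2,3)])
    fix x y :: 'a assume "x \<in> S \<and> y \<in> S \<and> x \<noteq> y"
    then obtain b where "b \<in> Basis" "x \<bullet> b \<noteq> y \<bullet> b"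
      by (metis euclidean_eqI)
    moreover have "monomial_span (\<lambda>x. (x \<bullet> b) * 1)"
      using \<open>b \<in> Basis\<close> by (intro monomial_span.coord monomial_span.const)
    ultimately show "\<exists>f. monomial_span f \<and> f x \<noteq> f y" by auto
  qed (auto intro: monomial_span.const monomial_span.add monomial_span_mult monomial_span_continuous)
  then show thesis using that by blast
qed

section \<open>Energies for powers of the inner product, and their relation to polynomial
  moments\<close>

definition power_form :: "(real^3) set \<Rightarrow> nat \<Rightarrow> (real^3 \<Rightarrow> real^3) \<Rightarrow> real" where
  "power_form \<Omega> n w = (LINT p|(lebesgue_on \<Omega> \<Otimes>\<^sub>M lebesgue_on \<Omega>). (fst p \<bullet> snd p) ^ n * (w (fst p) \<bullet> w (snd p)))"

lemma pair_sigma_finite_lebesgue_on: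
  assumes "\<Omega> \<in> lmeasurable"
  shows "pair_sigma_finite (lebesgue_on \<Omega>) (lebesgue_on \<Omega>)"
proof -
  interpret finite_measure "lebesgue_on \<Omega>"
    using assms by (rule finite_measure_lebesgue_on)
  show ?thesis by unfold_locales
qed

lemma integrable_scaleR_continuous:
  fixes w :: "'a::euclidean_space \<Rightarrow> 'b::euclidean_space"
  assumes "bounded \<Omega>" "continuous_on UNIV p" "integrable (lebesgue_on \<Omega>) w"
  shows "integrable (lebesgue_on \<Omega>) (\<lambda>x. p x *\<^sub>R w x)"
proof -
  have "compact (p ` closure \<Omega>)"
    using assms by (intro compact_continuous_image) (auto intro: continuous_on_subset)
  from compact_imp_bounded[OF this]
  obtain C where C: "\<And>x. x \<in> closure \<Omega> \<Longrightarrow> norm (p x) \<le> C"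
    unfolding bounded_iff by blast
  have [measurable]: "p \<in> borel_measurable (lebesgue_on \<Omega>)"
    by (rule measurable_compose[OF ident_borel_measurable_lebesgue_on borel_measurable_continuous_onI[OF assms(2)]])
  note [measurable] = borel_measurable_integrable[OF assms(3)]
  have "integrable (lebesgue_on \<Omega>) (\<lambda>x. C * norm (w x))"
    using assms(3) by simp
  then show ?thesis
  proof (rule Bochner_Integration.integrable_bound)
    show "AE x in lebesgue_on \<Omega>. norm (p x *\<^sub>R w x) \<le> norm (C * norm (w x))"
    proof (rule AE_I2)
      fix x assume "x \<in> space (lebesgue_on \<Omega>)"
      then have "\<bar>p x\<bar> \<le> C" using C[of x] closure_subset by auto
      then show "norm (p x *\<^sub>R w x) \<le> norm (C * norm (w x))"
        by (simp add: abs_mult mult_right_mono)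
    qed
  qed measurable
qed

lemma integrable_pair_inner:
  fixes w :: "real^3 \<Rightarrow> real^3"
  assumes \<Omega>: "\<Omega> \<in> lmeasurable" and w: "integrable (lebesgue_on \<Omega>) w"
    and g: "g \<in> borel_measurable (lebesgue_on \<Omega> \<Otimes>\<^sub>M lebesgue_on \<Omega>)"
    and C: "\<And>x y. x \<in> \<Omega> \<Longrightarrow> y \<in> \<Omega> \<Longrightarrow> \<bar>g (x, y)\<bar> \<le> C"
  shows "integrable (lebesgue_on \<Omega> \<Otimes>\<^sub>M lebesgue_on \<Omega>) (\<lambda>p. g p * (w (fst p) \<bullet> w (snd p)))"
proof -
  let ?M = "lebesgue_on \<Omega>"
  interpret pair_sigma_finite ?M ?M
    by (rule pair_sigma_finite_lebesgue_on[OF \<Omega>])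
  note [measurable] = borel_measurable_integrable[OF w] g
  have 1: "integrable (?M \<Otimes>\<^sub>M ?M) (\<lambda>p. norm (w (fst p)) * norm (w (snd p)))"
    by (rule Fubini_integrable) (use w in auto)
  have "integrable (?M \<Otimes>\<^sub>M ?M) (\<lambda>p. C * (norm (w (fst p)) * norm (w (snd p))))"
    using 1 by simp
  then show ?thesis
  proof (rule Bochner_Integration.integrable_bound)
    show "AE p in ?M \<Otimes>\<^sub>M ?M. norm (g p * (w (fst p) \<bullet> w (snd p))) \<le> norm (C * (norm (w (fst p)) * norm (w (snd p))))"
    proof (rule AE_I2)
      fix p assume "p \<in> space (?M \<Otimes>\<^sub>M ?M)"
      then have "\<bar>g p\<bar> \<le> C" using C[of "fst p" "snd p"] by (auto simp: space_pair_measure)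
      then have "\<bar>g p\<bar> * \<bar>w (fst p) \<bullet> w (snd p)\<bar> \<le> C * (norm (w (fst p)) * norm (w (snd p)))"
        by (intro mult_mono Cauchy_Schwarz_ineq2) auto
      from order_trans[OF this abs_ge_self]
      show "norm (g p * (w (fst p) \<bullet> w (snd p))) \<le> norm (C * (norm (w (fst p)) * norm (w (snd p))))"
        by (simp only: real_norm_def abs_mult[of "g p"])
    qed
  qed measurable
qed

lemma abs_inner_power_le:
  assumes "norm x \<le> B" "norm y \<le> B"
  shows "\<bar>(x \<bullet> y) ^ n\<bar> \<le> (B\<^sup>2) ^ n"
proof -
  have "B \<ge> 0" using norm_ge_zero assms(1) by (rule order_trans)
  have "\<bar>x \<bullet> y\<bar> \<le> norm x * norm y" by (rule Cauchy_Schwarz_ineq2)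
  also have "\<dots> \<le> B * B"
    using assms \<open>B \<ge> 0\<close> by (intro mult_mono) auto
  finally show ?thesis by (simp add: power_abs power2_eq_square power_mono)
qed

lemma integrable_power_form:
  fixes w :: "real^3 \<Rightarrow> real^3"
  assumes "\<Omega> \<in> lmeasurable" "bounded \<Omega>" "integrable (lebesgue_on \<Omega>) w"
  shows "integrable (lebesgue_on \<Omega> \<Otimes>\<^sub>M lebesgue_on \<Omega>) (\<lambda>p. (fst p \<bullet> snd p) ^ n * (w (fst p) \<bullet> w (snd p)))"
proof -
  obtain B where "\<And>x. x \<in> \<Omega> \<Longrightarrow> norm x \<le> B"
    using assms(2) unfolding bounded_iff by blast
  then show ?thesis
    by (intro integrable_pair_inner[where C = "(B\<^sup>2) ^ n"] assms)
       (auto intro!: abs_inner_power_le)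
qed

lemma power_form_0:
  assumes "\<Omega> \<in> lmeasurable" "bounded \<Omega>" "integrable (lebesgue_on \<Omega>) w"
  shows "power_form \<Omega> 0 w = (norm (LINT x|lebesgue_on \<Omega>. w x))\<^sup>2"
proof -
  interpret pair_sigma_finite "lebesgue_on \<Omega>" "lebesgue_on \<Omega>"
    by (rule pair_sigma_finite_lebesgue_on[OF assms(1)])
  have "power_form \<Omega> 0 w = (LINT x|lebesgue_on \<Omega>. LINT y|lebesgue_on \<Omega>. w x \<bullet> w y)"
    using integral_fst'[OF integrable_power_form[OF assms, of 0]]
    by (simp add: power_form_def)
  also have "\<dots> = (LINT x|lebesgue_on \<Omega>. w x \<bullet> (LINT y|lebesgue_on \<Omega>. w y))"
    using assms(3) by simp
  also have "\<dots> = (LINT x|lebesgue_on \<Omega>. w x) \<bullet> (LINT y|lebesgue_on \<Omega>. w y)"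
    using assms(3) by simp
  finally show ?thesis by (simp add: dot_square_norm)
qed

text \<open>One factor x . y is written as the sum of (x . b) (y . b) over the basis, and each
  coordinate is absorbed into the copy of \<open>w\<close> at the same point.\<close>

lemma power_form_Suc:
  assumes "\<Omega> \<in> lmeasurable" "bounded \<Omega>" "integrable (lebesgue_on \<Omega>) w"
  shows "power_form \<Omega> (Suc n) w = (\<Sum>b\<in>Basis. power_form \<Omega> n (\<lambda>x. (x \<bullet> b) *\<^sub>R w x))"
proof -
  have "(x \<bullet> y) ^ Suc n * (w x \<bullet> w y) 
    = (\<Sum>b\<in>Basis. (x \<bullet> y) ^ n * (((x \<bullet> b) *\<^sub>R w x) \<bullet> ((y \<bullet> b) *\<^sub>R w y)))" for x y
  proof -
    have "(x \<bullet> y) ^ Suc n * (w x \<bullet> w y) = (\<Sum>b\<in>Basis. (x \<bullet> b) * (y \<bullet> b)) * ((x \<bullet> y) ^ n * (w x \<bullet> w y))"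
      by (subst euclidean_inner[of x y, symmetric]) simp
    also have "\<dots> = (\<Sum>b\<in>Basis. (x \<bullet> y) ^ n * (((x \<bullet> b) *\<^sub>R w x) \<bullet> ((y \<bullet> b) *\<^sub>R w y)))"
      unfolding sum_distrib_right by (rule sum.cong[OF refl]) (simp add: mult_ac)
    finally show ?thesis .
  qed
  then have "power_form \<Omega> (Suc n) w = (LINT p|(lebesgue_on \<Omega> \<Otimes>\<^sub>M lebesgue_on \<Omega>).
      (\<Sum>b\<in>Basis. (fst p \<bullet> snd p) ^ n * (((fst p \<bullet> b) *\<^sub>R w (fst p)) \<bullet> ((snd p \<bullet> b) *\<^sub>R w (snd p)))))"
    by (simp only: power_form_def)
  also have "\<dots> = (\<Sum>b\<in>Basis. power_form \<Omega> n (\<lambda>x. (x \<bullet> b) *\<^sub>R w x))"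
    unfolding power_form_def
    by (intro Bochner_Integration.integral_sum integrable_power_form integrable_scaleR_continuous assms continuous_intros)
  finally show ?thesis .
qed

text \<open>Repeated use of \<open>power_form_Suc\<close> ends in a sum of forms of exponent 0, each
  the squared norm of a moment. The induction generalizes over \<open>w\<close> because the
  recursion changes the field.\<close>

lemma power_form_nonneg:
  assumes "\<Omega> \<in> lmeasurable" "bounded \<Omega>" "integrable (lebesgue_on \<Omega>) w"
  shows "power_form \<Omega> n w \<ge> 0"
  using assms(3)
proof (induction n arbitrary: w)
  case 0
  then show ?case by (simp add: power_form_0 assms)
next
  case (Suc n)
  show ?case
    unfolding power_form_Suc[OF assms(1,2) Suc.prems]
    by (intro sum_nonneg Suc.IH integrable_scaleR_continuous assms Suc.prems continuous_intros)
qed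

text \<open>A vanishing form of exponent n + 1 is a sum of nonnegative forms of exponent n for the
  fields multiplied by a coordinate. Each of these vanishes, so the hypothesis for all exponents
  passes to the multiplied field; exponent 0 handles the constants.\<close>

lemma power_form_zero_imp_moment_zero:
  assumes \<Omega>: "\<Omega> \<in> lmeasurable" "bounded \<Omega>"
    and "monomial_span p" "integrable (lebesgue_on \<Omega>) w" "\<And>n. power_form \<Omega> n w = 0"
  shows "(LINT x|lebesgue_on \<Omega>. p x *\<^sub>R w x) = 0"
  using assms(3-)
proof (induction arbitrary: w rule: monomial_span.induct)
  case (const c)
  have "(LINT x|lebesgue_on \<Omega>. w x) = 0"
    using power_form_0[OF \<Omega> const(1)] const(2)[of 0] by simp
  then show ?case by simp
next
  case (add p q)
  have "integrable (lebesgue_on \<Omega>) (\<lambda>x. p x *\<^sub>R w x)" "integrable (lebesgue_on \<Omega>) (\<lambda>x. q x *\<^sub>R w x)"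
    by (intro integrable_scaleR_continuous \<Omega> monomial_span_continuous add.prems add.hyps)+
  then show ?case
    using add by (simp add: scaleR_add_left)
next
  case (coord b p)
  have i: "integrable (lebesgue_on \<Omega>) (\<lambda>x. (x \<bullet> c) *\<^sub>R w x)" for c
    by (intro integrable_scaleR_continuous \<Omega> continuous_intros coord.prems)
  have "power_form \<Omega> n (\<lambda>x. (x \<bullet> b) *\<^sub>R w x) = 0" for n
  proof -
    have "(\<Sum>b\<in>Basis. power_form \<Omega> n (\<lambda>x. (x \<bullet> b) *\<^sub>R w x)) = 0"
      using power_form_Suc[OF \<Omega> coord.prems(1), of n] coord.prems(2) by simp
    then show ?thesis
      using coord.hyps(1) by (subst (asm) sum_nonneg_eq_0_iff) (auto intro: power_form_nonneg \<Omega> i)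
  qed
  from coord.IH[OF i this] show ?case by (simp add: mult.commute)
qed

text \<open>Uniform approximation extends the vanishing from polynomial to continuous multipliers.
  Continuous multipliers tending to the sign of a component of \<open>w\<close> then show that the
  integral of its absolute value is zero.\<close>

lemma moments_zero_imp_AE_zero:
  fixes w :: "real^3 \<Rightarrow> real^3"
  assumes \<Omega>: "\<Omega> \<in> lmeasurable" "bounded \<Omega>" and w: "integrable (lebesgue_on \<Omega>) w"
    and mom: "\<And>p. monomial_span p \<Longrightarrow> (LINT x|lebesgue_on \<Omega>. p x *\<^sub>R w x) = 0"
  shows "AE x in lebesgue_on \<Omega>. w x = 0"
proof -
  let ?M = "lebesgue_on \<Omega>"
  note [measurable] = borel_measurable_integrable[OF w]
  have cont: "(LINT x|?M. f x *\<^sub>R w x) = 0" if f: "continuous_on UNIV f" for f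
  proof -
    have "norm (LINT x|?M. f x *\<^sub>R w x) \<le> 0 + e" if "e > 0" for e
    proof -
      define I where "I = (LINT x|?M. norm (w x))"
      have "I \<ge> 0" by (simp add: I_def)
      \<comment> \<open>The 1 avoids dividing by zero when \<open>w\<close> vanishes almost
        everywhere.\<close>
      then have "e / (I + 1) > 0" using \<open>e > 0\<close> by simp
      then obtain p where p: "monomial_span p" "\<And>x. x \<in> closure \<Omega> \<Longrightarrow> \<bar>f x - p x\<bar> < e / (I + 1)"
        using monomial_span_dense[of "closure \<Omega>" f "e / (I + 1)"] \<Omega>(2) f
        by (auto intro: continuous_on_subset)
      have i: "integrable ?M (\<lambda>x. f x *\<^sub>R w x)" "integrable ?M (\<lambda>x. p x *\<^sub>R w x)"
        by (intro integrable_scaleR_continuous \<Omega> f w monomial_span_continuous p)+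
      have "(LINT x|?M. f x *\<^sub>R w x) = (LINT x|?M. f x *\<^sub>R w x - p x *\<^sub>R w x)"
        using i mom[OF p(1)] by simp
      also have "norm \<dots> \<le> (LINT x|?M. norm (f x *\<^sub>R w x - p x *\<^sub>R w x))"
        by (rule integral_norm_bound)
      also have "\<dots> \<le> (LINT x|?M. e / (I + 1) * norm (w x))"
      proof (rule integral_mono)
        fix x assume "x \<in> space ?M"
        then have "\<bar>f x - p x\<bar> \<le> e / (I + 1)" using p(2)[of x] closure_subset by force
        then show "norm (f x *\<^sub>R w x - p x *\<^sub>R w x) \<le> e / (I + 1) * norm (w x)"
          by (simp flip: scaleR_diff_left add: mult_right_mono del: times_divide_eq_left)
      qed (use i w in auto)
      also have "\<dots> = e / (I + 1) * I"
        by (simp add: I_def)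
      also have "\<dots> \<le> e"
        using \<open>I \<ge> 0\<close> \<open>e > 0\<close> by (simp add: field_simps)
      finally show ?thesis by simp
    qed
    then have "norm (LINT x|?M. f x *\<^sub>R w x) \<le> 0" by (rule field_le_epsilon)
    then show ?thesis by simp
  qed
  have "AE x in ?M. w x $ i = 0" for i
  proof -
    have wi: "integrable ?M (\<lambda>x. w x $ i)"
      using integrable_bounded_linear[OF bounded_linear_vec_nth w] .
    note [measurable] = borel_measurable_integrable[OF wi]
    have "(\<lambda>x. sgn (w x $ i)) \<in> borel_measurable ?M" by simp
    \<comment> \<open>This notion of measurability directly supplies continuous functions converging
      off a negligible set.\<close>
    then have "(\<lambda>x. sgn (w x $ i)) measurable_on \<Omega>"
      using \<Omega>(1) by (simp add: measurable_on_iff_borel_measurable fmeasurableD)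
    then obtain N g where N: "negligible N" and g: "\<And>n. continuous_on UNIV (g n)"
      and lim: "\<And>x. x \<notin> N \<Longrightarrow> (\<lambda>n. g n x) \<longlonglongrightarrow> (if x \<in> \<Omega> then sgn (w x $ i) else 0)"
      unfolding measurable_on_def by blast
    \<comment> \<open>Clamping to [-1, 1] leaves the limit unchanged, as a sign lies in this
      interval, and makes the absolute value of the component a dominating function.\<close>
    define h where "h n x = max (-1) (min 1 (g n x))" for n x
    have h: "continuous_on UNIV (h n)" for n
      unfolding h_def by (intro continuous_intros g)
    have h_meas[measurable]: "h n \<in> borel_measurable ?M" for n
      by (rule measurable_compose[OF ident_borel_measurable_lebesgue_on borel_measurable_continuous_onI[OF h]])
    have "(\<lambda>n. LINT x|?M. h n x * w x $ i) \<longlonglongrightarrow> (LINT x|?M. \<bar>w x $ i\<bar>)"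
    proof (rule integral_dominated_convergence[where w = "\<lambda>x. \<bar>w x $ i\<bar>"])
      show "integrable ?M (\<lambda>x. \<bar>w x $ i\<bar>)" using wi by simp
      have "AE x in lebesgue. x \<notin> N"
        using N by (auto simp: negligible_iff_null_sets intro: AE_not_in)
      then have "AE x in ?M. x \<notin> N"
        using \<Omega>(1) by (subst AE_restrict_space_iff) (auto simp: fmeasurableD)
      then show "AE x in ?M. (\<lambda>n. h n x * w x $ i) \<longlonglongrightarrow> \<bar>w x $ i\<bar>"
      proof (rule AE_mp, intro AE_I2 impI)
        fix x assume "x \<in> space ?M" "x \<notin> N"
        then have "(\<lambda>n. g n x) \<longlonglongrightarrow> sgn (w x $ i)" using lim[of x] by simp
        then have "(\<lambda>n. h n x * w x $ i) \<longlonglongrightarrow> max (-1) (min 1 (sgn (w x $ i))) * w x $ i"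
          unfolding h_def by (intro tendsto_intros)
        also have "max (-1) (min 1 (sgn (w x $ i))) * w x $ i = \<bar>w x $ i\<bar>"
          by (auto simp: sgn_if)
        finally show "(\<lambda>n. h n x * w x $ i) \<longlonglongrightarrow> \<bar>w x $ i\<bar>" .
      qed
      show "AE x in ?M. norm (h n x * w x $ i) \<le> \<bar>w x $ i\<bar>" for n
        by (intro AE_I2) (auto simp: h_def abs_mult intro!: mult_left_le_one_le)
    qed measurable
    moreover have "(LINT x|?M. h n x * w x $ i) = 0" for n
    proof -
      have "(LINT x|?M. h n x *\<^sub>R w x) $ i = (LINT x|?M. (h n x *\<^sub>R w x) $ i)"
        by (rule integral_bounded_linear[OF bounded_linear_vec_nth, symmetric])
           (intro integrable_scaleR_continuous \<Omega> h w)
      then show ?thesis using cont[OF h, of n] by simp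
    qed
    ultimately have "(LINT x|?M. \<bar>w x $ i\<bar>) = 0"
      by (simp add: LIMSEQ_const_iff)
    then show ?thesis
      using integral_nonneg_eq_0_iff_AE[of ?M "\<lambda>x. \<bar>w x $ i\<bar>"] wi by simp
  qed
  then have "AE x in ?M. \<forall>i. w x $ i = 0" by (simp add: AE_all_countable)
  then show ?thesis by eventually_elim (simp add: vec_eq_iff)
qed

text \<open>The power series of the exponential writes \<open>Q\<close> as a series of power forms
  with positive coefficients. All terms are nonnegative, so a vanishing sum kills every power form
  and with it every moment.\<close>

lemma exp_kernel_nonneg_zero:
  fixes w :: "real^3 \<Rightarrow> real^3"
  assumes \<Omega>: "\<Omega> \<in> lmeasurable" "bounded \<Omega>" and w: "integrable (lebesgue_on \<Omega>) w" and "c > 0"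
  defines "Q \<equiv> (LINT p|(lebesgue_on \<Omega> \<Otimes>\<^sub>M lebesgue_on \<Omega>). exp (c * (fst p \<bullet> snd p)) * (w (fst p) \<bullet> w (snd p)))"
  shows "Q \<ge> 0" and "Q = 0 \<Longrightarrow> AE x in lebesgue_on \<Omega>. w x = 0"
proof -
  let ?P = "lebesgue_on \<Omega> \<Otimes>\<^sub>M lebesgue_on \<Omega>"
  define f where "f n p = (c ^ n / fact n) * ((fst p \<bullet> snd p) ^ n * (w (fst p) \<bullet> w (snd p)))" for n p
  have f: "integrable ?P (f n)" for n
    unfolding f_def by (intro integrable_mult_right integrable_power_form \<Omega> w)
  have exp_sums: "(\<lambda>n. f n p) sums (exp (c * (fst p \<bullet> snd p)) * (w (fst p) \<bullet> w (snd p)))" for p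
    using sums_mult2[OF exp_converges[of "c * (fst p \<bullet> snd p)"], of "w (fst p) \<bullet> w (snd p)"]
    by (simp add: f_def power_mult_distrib divide_inverse mult_ac)
  obtain B where B: "\<And>x. x \<in> \<Omega> \<Longrightarrow> norm x \<le> B"
    using \<Omega>(2) unfolding bounded_iff by blast
  let ?N = "LINT p|?P. \<bar>w (fst p) \<bullet> w (snd p)\<bar>"
  have N: "integrable ?P (\<lambda>p. \<bar>w (fst p) \<bullet> w (snd p)\<bar>)"
    using integrable_power_form[OF \<Omega> w, of 0] by simp
  \<comment> \<open>The majorant is a term of the exponential series times a fixed integrable
    function. It provides both summability conditions needed to exchange sum and integral.\<close>
  have bound: "norm (f n p) \<le> (c * B\<^sup>2) ^ n / fact n * \<bar>w (fst p) \<bullet> w (snd p)\<bar>" if "p \<in> \<Omega> \<times> \<Omega>" for n p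
  proof -
    have "norm (f n p) = c ^ n / fact n * (\<bar>(fst p \<bullet> snd p) ^ n\<bar> * \<bar>w (fst p) \<bullet> w (snd p)\<bar>)"
      using \<open>c > 0\<close> by (simp add: f_def abs_mult)
    also have "\<dots> \<le> c ^ n / fact n * ((B\<^sup>2) ^ n * \<bar>w (fst p) \<bullet> w (snd p)\<bar>)"
      using that \<open>c > 0\<close> B by (intro mult_left_mono mult_right_mono abs_inner_power_le) auto
    finally show ?thesis by (simp add: power_mult_distrib)
  qed
  have ae: "AE p in ?P. summable (\<lambda>n. norm (f n p))"
  proof (rule AE_I2)
    fix p assume "p \<in> space ?P"
    then have p: "p \<in> \<Omega> \<times> \<Omega>" by (simp add: space_pair_measure)
    have "summable (\<lambda>n. (c * B\<^sup>2) ^ n / fact n * \<bar>w (fst p) \<bullet> w (snd p)\<bar>)"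
      using sums_summable[OF exp_converges[of "c * B\<^sup>2"]] by (intro summable_mult2) (simp add: divide_inverse mult.commute)
    then show "summable (\<lambda>n. norm (f n p))"
      by (rule summable_comparison_test'[where N = 0]) (use bound[OF p] in simp)
  qed
  have "summable (\<lambda>n. LINT p|?P. norm (f n p))"
  proof (rule summable_comparison_test'[where N = 0])
    show "summable (\<lambda>n. (c * B\<^sup>2) ^ n / fact n * ?N)"
      using sums_summable[OF exp_converges[of "c * B\<^sup>2"]] by (intro summable_mult2) (simp add: divide_inverse mult.commute)
    fix n
    have "(LINT p|?P. norm (f n p)) \<le> (LINT p|?P. (c * B\<^sup>2) ^ n / fact n * \<bar>w (fst p) \<bullet> w (snd p)\<bar>)"
    proof (rule integral_mono)
      show "norm (f n p) \<le> (c * B\<^sup>2) ^ n / fact n * \<bar>w (fst p) \<bullet> w (snd p)\<bar>" if "p \<in> space ?P" for p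
        using that by (intro bound) (simp add: space_pair_measure)
    qed (intro integrable_norm f integrable_mult_right N)+
    then show "norm (LINT p|?P. norm (f n p)) \<le> (c * B\<^sup>2) ^ n / fact n * ?N"
      by simp
  qed
  from sums_integral[OF f ae this]
  have sums: "(\<lambda>n. c ^ n / fact n * power_form \<Omega> n w) sums Q"
    unfolding Q_def power_form_def using exp_sums[THEN sums_unique] by (simp add: f_def)
  have nonneg: "c ^ n / fact n * power_form \<Omega> n w \<ge> 0" for n
    using \<open>c > 0\<close> by (intro mult_nonneg_nonneg power_form_nonneg \<Omega> w) auto
  show "Q \<ge> 0"
    using sums_le[OF _ sums_zero sums] nonneg by simp
  assume "Q = 0"
  with sums have "(\<Sum>n. c ^ n / fact n * power_form \<Omega> n w) = 0" "summable (\<lambda>n. c ^ n / fact n * power_form \<Omega> n w)"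
    by (auto simp: sums_iff)
  then have "c ^ n / fact n * power_form \<Omega> n w = 0" for n
    using nonneg by (subst (asm) suminf_eq_zero_iff) auto
  then have "power_form \<Omega> n w = 0" for n
    using \<open>c > 0\<close> by simp
  then show "AE x in lebesgue_on \<Omega>. w x = 0"
    by (intro moments_zero_imp_AE_zero power_form_zero_imp_moment_zero \<Omega> w)
qed

text \<open>Expanding the square of norm (x - y) leaves the exponential kernel with constant 2 t^2,
  once the factors depending on one point only are moved into the field. These factors are positive,
  so the new field vanishes exactly where \<open>v\<close> does.\<close>

lemma gaussian_kernel_nonneg_zero:
  fixes v :: "real^3 \<Rightarrow> real^3"
  assumes \<Omega>: "\<Omega> \<in> lmeasurable" "bounded \<Omega>" and v: "integrable (lebesgue_on \<Omega>) v" and "t \<noteq> 0"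
  defines "Q \<equiv> (LINT p|(lebesgue_on \<Omega> \<Otimes>\<^sub>M lebesgue_on \<Omega>).
      exp (- (t\<^sup>2 * (norm (fst p - snd p))\<^sup>2)) * (v (fst p) \<bullet> v (snd p)))"
  shows "Q \<ge> 0" and "Q = 0 \<Longrightarrow> AE x in lebesgue_on \<Omega>. v x = 0"
proof -
  define w where "w x = exp (- (t\<^sup>2 * (norm x)\<^sup>2)) *\<^sub>R v x" for x
  have w: "integrable (lebesgue_on \<Omega>) w"
    unfolding w_def by (intro integrable_scaleR_continuous \<Omega> v continuous_intros)
  have "exp (- (t\<^sup>2 * (norm (x - y))\<^sup>2)) * (v x \<bullet> v y) = exp (2 * t\<^sup>2 * (x \<bullet> y)) * (w x \<bullet> w y)" for x y
  proof -
    have "- (t\<^sup>2 * (norm (x - y))\<^sup>2) = 2 * t\<^sup>2 * (x \<bullet> y) + (- (t\<^sup>2 * (norm x)\<^sup>2)) + (- (t\<^sup>2 * (norm y)\<^sup>2))"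
      by (simp add: power2_norm_eq_inner inner_diff_left inner_diff_right inner_commute algebra_simps)
    then show ?thesis by (simp only: exp_add w_def inner_scaleR_left inner_scaleR_right mult_ac)
  qed
  then have Q: "Q = (LINT p|(lebesgue_on \<Omega> \<Otimes>\<^sub>M lebesgue_on \<Omega>). exp (2 * t\<^sup>2 * (fst p \<bullet> snd p)) * (w (fst p) \<bullet> w (snd p)))"
    by (simp only: Q_def)
  have "2 * t\<^sup>2 > 0" using \<open>t \<noteq> 0\<close> by simp
  note * = exp_kernel_nonneg_zero[OF \<Omega> w this, folded Q]
  show "Q \<ge> 0" by (rule *)
  assume "Q = 0"
  from *(2)[OF this] show "AE x in lebesgue_on \<Omega>. v x = 0"
    by eventually_elim (simp add: w_def)
qed

section \<open>The Newtonian kernel as a superposition of Gaussians\<close>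

lemma has_bochner_integral_gaussian_inverse:
  fixes d :: real
  assumes "d > 0"
  shows "has_bochner_integral lborel (\<lambda>t. exp (- (t\<^sup>2 * d\<^sup>2))) (sqrt pi / d)"
proof -
  \<comment> \<open>The standard deviation for which the exponent - t^2 / (2 s^2) of the normal
    density is - t^2 d^2.\<close>
  define s where "s = 1 / (sqrt 2 * d)"
  have "s > 0" using assms by (simp add: s_def)
  have s2: "2 * s\<^sup>2 = 1 / d\<^sup>2" using assms by (simp add: s_def power_mult_distrib power_divide)
  have "has_bochner_integral lborel (normal_density 0 s) 1"
    using \<open>s > 0\<close> by (simp add: has_bochner_integral_iff)
  then have "has_bochner_integral lborel (\<lambda>t. (sqrt pi / d) * normal_density 0 s t) ((sqrt pi / d) * 1)"
    by (rule has_bochner_integral_mult_right)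
  moreover have "(sqrt pi / d) * normal_density 0 s t = exp (- (t\<^sup>2 * d\<^sup>2))" for t
  proof -
    have "2 * pi * s\<^sup>2 = pi / d\<^sup>2" using s2 by (simp add: field_simps)
    then have "sqrt (2 * pi * s\<^sup>2) = sqrt pi / d"
      using assms by (simp add: real_sqrt_divide)
    then show ?thesis using assms s2 by (simp add: normal_density_def)
  qed
  ultimately show ?thesis by simp
qed

text \<open>
  Since \<open>1 / d\<close> is a multiple of the integral of \<open>exp (- t\<^sup>2 d\<^sup>2)\<close> over all real \<open>t\<close>,
  the Newtonian energy is a superposition of Gaussian energies, each of which is positive definite.
\<close>
lemma A_op_positive_definite:
  assumes \<Omega>: "\<Omega> \<in> lmeasurable" "bounded \<Omega>" and "\<mu> > 0" and v: "v \<in> L2 \<Omega>"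
    and le: "l2_inner \<Omega> (A_op \<mu> \<Omega> v) v \<le> 0"
  shows "AE x in lebesgue_on \<Omega>. v x = 0"
proof -
  let ?M = "lebesgue_on \<Omega>"
  let ?P = "?M \<Otimes>\<^sub>M ?M"
  let ?N = "\<lambda>p. (1 / norm (fst p - snd p)) * (v (fst p) \<bullet> v (snd p))"
  let ?G = "\<lambda>p t. exp (- (t\<^sup>2 * (norm (fst p - snd p))\<^sup>2)) * (v (fst p) \<bullet> v (snd p))"
  obtain C where C: "C \<ge> 0" "\<And>x. x \<in> \<Omega> \<Longrightarrow> (\<lambda>y. 1 / norm (x - y)) \<in> L2 \<Omega>"
    "\<And>x. x \<in> \<Omega> \<Longrightarrow> l2_norm \<Omega> (\<lambda>y. 1 / norm (x - y)) \<le> C"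
    using newton_kernel_L2[OF fmeasurableD[OF \<Omega>(1)] \<Omega>(2)] by blast
  interpret finite_measure ?M using \<Omega>(1) by (rule finite_measure_lebesgue_on)
  interpret MM: pair_sigma_finite ?M ?M
    by (rule pair_sigma_finite_lebesgue_on[OF \<Omega>(1)])
  interpret P: pair_sigma_finite ?P lborel
    by (simp add: pair_sigma_finite_def MM.sigma_finite_measure_axioms sigma_finite_lborel)
  note [measurable] = L2_measurable[OF v]
  have v1: "integrable ?M v" by (rule L2_integrable[OF \<Omega>(1) v])
  have abs_le: "(LINT y|?M. norm (?N (x, y))) \<le> C * l2_norm \<Omega> v * norm (v x)"
    and int_y: "integrable ?M (\<lambda>y. ?N (x, y))" if "x \<in> \<Omega>" for x
  proof -
    have i: "integrable ?M (\<lambda>y. norm (v x) * (1 / norm (x - y) * norm (v y)))"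
      by (intro integrable_mult_right) (use L2_integrable_norm_mult[OF C(2)[OF that] v] in simp)
    have le: "norm (?N (x, y)) \<le> norm (v x) * (1 / norm (x - y) * norm (v y))" for y
      using mult_left_mono[OF Cauchy_Schwarz_ineq2[of "v x" "v y"], of "1 / norm (x - y)"]
      by (simp add: abs_mult mult_ac)
    show int: "integrable ?M (\<lambda>y. ?N (x, y))"
      by (rule Bochner_Integration.integrable_bound[OF i]) (use le in \<open>auto intro: order_trans[OF _ abs_ge_self]\<close>)
    have "(LINT y|?M. norm (?N (x, y))) \<le> (LINT y|?M. norm (v x) * (1 / norm (x - y) * norm (v y)))"
      by (intro integral_mono integrable_norm int i le)
    also have "\<dots> = norm (v x) * l2_inner \<Omega> (\<lambda>y. 1 / norm (x - y)) (\<lambda>y. norm (v y))"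
      by (simp only: integral_mult_right_zero l2_inner_def inner_real_def)
    also have "\<dots> \<le> norm (v x) * (l2_norm \<Omega> (\<lambda>y. 1 / norm (x - y)) * l2_norm \<Omega> v)"
      using l2_Cauchy_Schwarz[OF C(2)[OF that] L2_norm[OF v]]
      by (intro mult_left_mono) (auto simp: l2_norm_norm)
    also have "\<dots> \<le> norm (v x) * (C * l2_norm \<Omega> v)"
      by (intro mult_left_mono mult_right_mono C that l2_norm_nonneg norm_ge_zero)
    finally show "(LINT y|?M. norm (?N (x, y))) \<le> C * l2_norm \<Omega> v * norm (v x)"
      by (simp add: mult_ac)
  qed
  \<comment> \<open>By \<open>abs_le\<close> the inner integral of the absolute value is at most a
    constant times \<open>norm (v x)\<close>, which is integrable because the measure is
    finite.\<close>
  have intN: "integrable ?P ?N"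
  proof (rule MM.Fubini_integrable)
    show "?N \<in> borel_measurable ?P" by measurable
    have "integrable ?M (\<lambda>x. C * l2_norm \<Omega> v * norm (v x))" using v1 by simp
    then show "integrable ?M (\<lambda>x. LINT y|?M. norm (?N (x, y)))"
    proof (rule Bochner_Integration.integrable_bound)
      show "(\<lambda>x. LINT y|?M. norm (?N (x, y))) \<in> borel_measurable ?M"
        by (rule borel_measurable_lebesgue_integral) measurable
      show "AE x in ?M. norm (LINT y|?M. norm (?N (x, y))) \<le> norm (C * l2_norm \<Omega> v * norm (v x))"
      proof (rule AE_I2)
        fix x assume "x \<in> space ?M"
        then have "(LINT y|?M. norm (?N (x, y))) \<le> C * l2_norm \<Omega> v * norm (v x)"
          by (intro abs_le) simp
        moreover have "(LINT y|?M. norm (?N (x, y))) \<ge> 0" by (intro Bochner_Integration.integral_nonneg norm_ge_zero)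
        ultimately show "norm (LINT y|?M. norm (?N (x, y))) \<le> norm (C * l2_norm \<Omega> v * norm (v x))"
          unfolding real_norm_def by linarith
      qed
    qed
    show "AE x in ?M. integrable ?M (\<lambda>y. ?N (x, y))"
      using int_y by (intro AE_I2) simp
  qed
  have energy: "l2_inner \<Omega> (A_op \<mu> \<Omega> v) v = \<mu> / (4 * pi) * (LINT p|?P. ?N p)"
  proof -
    have "(LINT p|?P. ?N p) = (LINT x|?M. LINT y|?M. ?N (x, y))"
      by (rule MM.integral_fst'[OF intN, symmetric])
    also have "\<dots> = (LINT x|?M. (LINT y|?M. (1 / norm (x - y)) *\<^sub>R v y) \<bullet> v x)"
    proof (rule Bochner_Integration.integral_cong[OF refl])
      fix x assume "x \<in> space ?M"
      then have x: "x \<in> \<Omega>" by simp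
      have "(LINT y|?M. (1 / norm (x - y)) *\<^sub>R v y) \<bullet> v x = (LINT y|?M. ((1 / norm (x - y)) *\<^sub>R v y) \<bullet> v x)"
        using A_op_integrable[OF C(2)[OF x] v] by (intro integral_inner_left[symmetric])
      then show "(LINT y|?M. ?N (x, y)) = (LINT y|?M. (1 / norm (x - y)) *\<^sub>R v y) \<bullet> v x"
        by (simp add: inner_commute)
    qed
    finally show ?thesis by (simp add: l2_inner_def A_op_def)
  qed
  \<comment> \<open>On the diagonal the Gaussians are constant in \<open>t\<close>, so their
    integral does not represent the kernel there. Points are null sets, hence so is the
    diagonal.\<close>
  have diag: "AE p in ?P. fst p \<noteq> snd p"
  proof (rule MM.AE_pair_measure)
    show "{p \<in> space ?P. fst p \<noteq> snd p} \<in> sets ?P" by measurable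
    have "AE y in ?M. x \<noteq> y" for x
    proof -
      have "AE y in lebesgue. y \<notin> {x}"
        by (rule AE_not_in) (simp add: negligible_iff_null_sets[symmetric])
      then have "AE y in ?M. y \<notin> {x}"
        using \<Omega>(1) by (subst AE_restrict_space_iff) (auto simp: fmeasurableD)
      then show ?thesis by eventually_elim auto
    qed
    then show "AE x in ?M. AE y in ?M. fst (x, y) \<noteq> snd (x, y)" by simp
  qed
  have G: "has_bochner_integral lborel (?G p) (sqrt pi * ?N p)"
    "(LINT t|lborel. norm (?G p t)) = sqrt pi * norm (?N p)" if "fst p \<noteq> snd p" for p
  proof -
    have "norm (fst p - snd p) > 0" using that by simp
    note * = has_bochner_integral_mult_left[OF has_bochner_integral_gaussian_inverse[OF this]]
    from *[of "v (fst p) \<bullet> v (snd p)"] show "has_bochner_integral lborel (?G p) (sqrt pi * ?N p)"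
      by simp
    from *[of "\<bar>v (fst p) \<bullet> v (snd p)\<bar>"] 
    show "(LINT t|lborel. norm (?G p t)) = sqrt pi * norm (?N p)"
      by (simp add: has_bochner_integral_iff abs_mult)
  qed
  \<comment> \<open>By \<open>G\<close>, integrating the absolute value over \<open>t\<close> first
    gives a multiple of the absolute Newtonian integrand, so \<open>intN\<close> justifies
    exchanging the integrals.\<close>
  have intG: "integrable (?P \<Otimes>\<^sub>M lborel) (\<lambda>(p, t). ?G p t)"
  proof (rule P.Fubini_integrable)
    show "(\<lambda>(p, t). ?G p t) \<in> borel_measurable (?P \<Otimes>\<^sub>M lborel)" by measurable
    have "integrable ?P (\<lambda>p. sqrt pi * norm (?N p))" using intN by (intro integrable_mult_right integrable_norm)
    then show "integrable ?P (\<lambda>p. LINT t|lborel. norm (case (p, t) of (p, t) \<Rightarrow> ?G p t))"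
    proof (rule integrable_cong_AE_imp)
      show "(\<lambda>p. LINT t|lborel. norm (case (p, t) of (p, t) \<Rightarrow> ?G p t)) \<in> borel_measurable ?P"
        by (rule lborel.borel_measurable_lebesgue_integral) measurable
      show "AE p in ?P. sqrt pi * norm (?N p) = (LINT t|lborel. norm (case (p, t) of (p, t) \<Rightarrow> ?G p t))"
        using diag by eventually_elim (simp only: G(2) prod.case not_False_eq_True)
    qed
    show "AE p in ?P. integrable lborel (\<lambda>t. case (p, t) of (p, t) \<Rightarrow> ?G p t)"
      using diag by eventually_elim (use G(1) in \<open>simp add: has_bochner_integral_iff\<close>)
  qed
  define Q where "Q t = (LINT p|?P. ?G p t)" for t
  have "(LINT t|lborel. Q t) = (LINT p|?P. LINT t|lborel. ?G p t)"
    unfolding Q_def using P.integral_fst[OF intG] P.integral_snd[OF intG] by simp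
  also have "\<dots> = (LINT p|?P. sqrt pi * ?N p)"
  proof (rule integral_cong_AE)
    show "(\<lambda>p. LINT t|lborel. ?G p t) \<in> borel_measurable ?P"
      by (rule lborel.borel_measurable_lebesgue_integral) measurable
    show "AE p in ?P. (LINT t|lborel. ?G p t) = sqrt pi * ?N p"
      using diag by eventually_elim (use G(1) in \<open>simp add: has_bochner_integral_iff\<close>)
  qed measurable
  also have "\<dots> = sqrt pi * (LINT p|?P. ?N p)" by (rule integral_mult_right_zero)
  also have "\<dots> \<le> 0"
  proof -
    have "\<mu> / (4 * pi) > 0" using \<open>\<mu> > 0\<close> by simp
    then have "(LINT p|?P. ?N p) \<le> 0"
      using le mult_le_cancel_left_pos[of "\<mu> / (4 * pi)" "LINT p|?P. ?N p" 0] unfolding energy by simp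
    then show ?thesis by (intro mult_nonneg_nonpos) auto
  qed
  finally have "(LINT t|lborel. Q t) \<le> 0" .
  \<comment> \<open>At t = 0 the kernel is constantly 1 and the energy is the squared norm of the
    integral of \<open>v\<close>, which can vanish for nonzero \<open>v\<close>.\<close>
  have Q0: "AE t in lborel. t \<noteq> (0::real)"
    by (rule AE_lborel_singleton)
  then have Qpos: "AE t in lborel. Q t \<ge> 0"
    by eventually_elim (simp add: Q_def gaussian_kernel_nonneg_zero[OF \<Omega> v1])
  have Qint: "integrable lborel Q"
    unfolding Q_def by (rule P.integrable_snd[OF intG])
  have "(LINT t|lborel. Q t) = 0"
    using \<open>(LINT t|lborel. Q t) \<le> 0\<close> integral_nonneg_AE[OF Qpos] by simp
  then have "AE t in lborel. Q t = 0"
    using integral_nonneg_eq_0_iff_AE[OF Qint Qpos] by simp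
  with Q0 have ae: "AE t in lborel. Q t = 0 \<and> t \<noteq> 0" by eventually_elim blast
  \<comment> \<open>A single parameter is enough, since the energy of every proper Gaussian is
    definite. It exists because the real line is not a null set.\<close>
  obtain t where "Q t = 0" "t \<noteq> 0"
  proof (rule ccontr)
    assume "\<not> thesis"
    with that have no: "\<And>t. \<not> (Q t = 0 \<and> t \<noteq> 0)" by blast
    have "AE t::real in lborel. False" by (rule eventually_mono[OF ae]) (use no in blast)
    then show False by (simp add: eventually_False ae_filter_eq_bot_iff)
  qed
  then show ?thesis
    using gaussian_kernel_nonneg_zero(2)[OF \<Omega> v1, of t] by (simp add: Q_def)
qed

section \<open>Linearity of the solenoidal space\<close>

lemma sum_split_at:
  fixes f :: "nat \<Rightarrow> 'b::comm_monoid_add"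
  assumes "M \<le> N"
  shows "(\<Sum>k=1..N. f k) = (\<Sum>k=1..M. f k) + (\<Sum>k\<in>{M<..N}. f k)"
proof -
  have un: "{1..N} = {1..M} \<union> {M<..N}" using assms by auto
  show ?thesis unfolding un by (rule sum.union_disjoint) auto
qed

text \<open>Serves to evaluate the definite description in \<open>gradient\<close>.\<close>

lemma gderiv_unique:
  assumes "GDERIV f x :> D" "GDERIV f x :> D'"
  shows "D = D'"
proof -
  have "(\<lambda>h. h \<bullet> D) = (\<lambda>h. h \<bullet> D')"
    using assms unfolding gderiv_def by (rule has_derivative_unique)
  then have "(D - D') \<bullet> D = (D - D') \<bullet> D'" by (rule fun_cong)
  then have "(D - D') \<bullet> (D - D') = 0" by (simp add: inner_diff_right)
  then show ?thesis by simp
qed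

text \<open>Needed for the additivity of the weak divergence condition: an integral against a
  gradient can be split only if both parts are integrable. A test function has a continuous
  gradient, which is bounded on the bounded domain.\<close>

lemma gradient_L2:
  assumes \<Omega>: "\<Omega> \<in> lmeasurable" "bounded \<Omega>" and "test_function \<Omega> \<psi>"
  shows "gradient \<psi> \<in> L2 \<Omega>"
proof -
  have "Ck (Suc 0) \<psi>" using assms(3) by (simp only: test_function_def)
  then obtain g where g: "\<And>x. GDERIV \<psi> x :> g x" "\<And>i. continuous_on UNIV (\<lambda>x. g x $ i)"
    by auto
  have "gradient \<psi> x = g x" for x
    unfolding gradient_def using g(1) by (blast intro: gderiv_unique)
  then have eq: "gradient \<psi> = g" by blast
  have cont: "continuous_on UNIV g"
    using continuous_on_vec_lambda[of UNIV "\<lambda>i x. g x $ i"] g(2) by simp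
  have "compact (g ` closure \<Omega>)"
    using \<Omega>(2) cont by (intro compact_continuous_image) (auto intro: continuous_on_subset)
  from compact_imp_bounded[OF this]
  obtain C where C: "\<And>x. x \<in> closure \<Omega> \<Longrightarrow> norm (g x) \<le> C"
    unfolding bounded_iff by blast
  show ?thesis
    unfolding eq
  proof (rule L2_bounded[OF \<Omega>(1)])
    show "g \<in> borel_measurable (lebesgue_on \<Omega>)"
      by (rule measurable_compose[OF ident_borel_measurable_lebesgue_on borel_measurable_continuous_onI[OF cont]])
    show "norm (g x) \<le> C" if "x \<in> \<Omega>" for x
      using C[of x] that closure_subset by blast
  qed
qed

lemma HL_L2: "v \<in> HL \<Omega> \<Longrightarrow> v \<in> L2 \<Omega>"
  by (simp add: HL_def)

lemma HL_zero: "(\<lambda>x. 0) \<in> HL \<Omega>"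
  by (simp add: HL_def L2_zero has_weak_div_def zero_normal_trace_def l2_inner_zero_left)

lemma HL_scaleR: "v \<in> HL \<Omega> \<Longrightarrow> (\<lambda>x. c *\<^sub>R v x) \<in> HL \<Omega>"
  by (simp add: HL_def L2_scaleR has_weak_div_def zero_normal_trace_def l2_inner_zero_left l2_inner_scaleR_left)

lemma HL_add:
  assumes "\<Omega> \<in> lmeasurable" "bounded \<Omega>" "u \<in> HL \<Omega>" "v \<in> HL \<Omega>"
  shows "(\<lambda>x. u x + v x) \<in> HL \<Omega>"
proof -
  have "u \<in> L2 \<Omega>" "v \<in> L2 \<Omega>" using assms by (auto intro: HL_L2)
  then show ?thesis
    using assms
    by (simp add: HL_def L2_add has_weak_div_def zero_normal_trace_def l2_inner_zero_left
        l2_inner_add_left gradient_L2)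
qed

lemma HL_diff:
  assumes "\<Omega> \<in> lmeasurable" "bounded \<Omega>" "u \<in> HL \<Omega>" "v \<in> HL \<Omega>"
  shows "(\<lambda>x. u x - v x) \<in> HL \<Omega>"
  using HL_add[OF assms(1-3) HL_scaleR[OF assms(4), of "-1"]] by simp

lemma HL_sum:
  assumes "\<Omega> \<in> lmeasurable" "bounded \<Omega>" "\<And>k. k \<in> I \<Longrightarrow> f k \<in> HL \<Omega>"
  shows "(\<lambda>x. \<Sum>k\<in>I. f k x) \<in> HL \<Omega>"
  using assms(3) by (induction I rule: infinite_finite_induct) (auto intro: HL_zero HL_add assms(1,2))

section \<open>Orthonormal systems for the weighted inner product\<close>

lemma Linf_plusE:
  assumes "\<eta> \<in> Linf_plus \<Omega>"
  obtains c C where "c > 0" "C \<ge> 0" "\<eta> \<in> borel_measurable (lebesgue_on \<Omega>)"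
    "AE x in lebesgue_on \<Omega>. c \<le> \<eta> x" "AE x in lebesgue_on \<Omega>. \<bar>\<eta> x\<bar> \<le> C"
proof -
  obtain C c where *: "c > 0" "\<eta> \<in> borel_measurable (lebesgue_on \<Omega>)"
    "AE x in lebesgue_on \<Omega>. c \<le> \<eta> x" "AE x in lebesgue_on \<Omega>. \<bar>\<eta> x\<bar> \<le> C"
    using assms unfolding Linf_plus_def by blast
  have "AE x in lebesgue_on \<Omega>. \<bar>\<eta> x\<bar> \<le> \<bar>C\<bar>"
    using *(4) by eventually_elim simp
  with * show thesis using that[of c "\<bar>C\<bar>"] by simp
qed

lemma weighted_measurable:
  "\<eta> \<in> borel_measurable (lebesgue_on \<Omega>) \<Longrightarrow> v \<in> borel_measurable (lebesgue_on \<Omega>) \<Longrightarrow>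
    weighted \<eta> v \<in> borel_measurable (lebesgue_on \<Omega>)"
  unfolding weighted_def by (rule borel_measurable_scaleR)

lemma weighted_L2:
  assumes "\<eta> \<in> Linf_plus \<Omega>" "v \<in> L2 \<Omega>"
  shows "weighted \<eta> v \<in> L2 \<Omega>"
proof -
  obtain c C where c: "c > 0" "C \<ge> 0" "\<eta> \<in> borel_measurable (lebesgue_on \<Omega>)"
    "AE x in lebesgue_on \<Omega>. c \<le> \<eta> x" "AE x in lebesgue_on \<Omega>. \<bar>\<eta> x\<bar> \<le> C"
    by (rule Linf_plusE[OF assms(1)])
  show ?thesis
  proof (rule L2_bound[OF assms(2) weighted_measurable[OF c(3) L2_measurable[OF assms(2)]]])
    show "AE x in lebesgue_on \<Omega>. norm (weighted \<eta> v x) \<le> C * norm (v x)"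
      using c(5) by eventually_elim (simp add: weighted_def mult_right_mono)
  qed
qed

lemma weighted_inner_commute: "l2_inner \<Omega> (weighted \<eta> u) v = l2_inner \<Omega> (weighted \<eta> v) u"
  by (simp add: l2_inner_def weighted_def inner_commute)

lemma weighted_inner_move: "l2_inner \<Omega> u (weighted \<eta> v) = l2_inner \<Omega> (weighted \<eta> u) v"
  by (simp add: l2_inner_def weighted_def)

lemma weighted_coercive:
  assumes "v \<in> L2 \<Omega>" "\<eta> \<in> Linf_plus \<Omega>" "AE x in lebesgue_on \<Omega>. c \<le> \<eta> x"
  shows "c * (l2_norm \<Omega> v)\<^sup>2 \<le> l2_inner \<Omega> (weighted \<eta> v) v"
proof -
  have "c * (l2_norm \<Omega> v)\<^sup>2 = (LINT x|lebesgue_on \<Omega>. c * (v x \<bullet> v x))"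
    by (simp only: l2_norm_sq l2_inner_def integral_mult_right_zero)
  also have "\<dots> \<le> (LINT x|lebesgue_on \<Omega>. weighted \<eta> v x \<bullet> v x)"
  proof (rule integral_mono_AE)
    show "integrable (lebesgue_on \<Omega>) (\<lambda>x. c * (v x \<bullet> v x))"
      using assms by (intro integrable_mult_right L2_integrable_inner)
    show "integrable (lebesgue_on \<Omega>) (\<lambda>x. weighted \<eta> v x \<bullet> v x)"
      using assms by (intro L2_integrable_inner weighted_L2)
    show "AE x in lebesgue_on \<Omega>. c * (v x \<bullet> v x) \<le> weighted \<eta> v x \<bullet> v x"
      using assms(3) by eventually_elim (simp add: weighted_def mult_right_mono)
  qed
  finally show ?thesis by (simp add: l2_inner_def)
qed

lemma weighted_inner_self_nonneg:
  assumes "v \<in> L2 \<Omega>" "\<eta> \<in> Linf_plus \<Omega>"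
  shows "l2_inner \<Omega> (weighted \<eta> v) v \<ge> 0"
proof -
  obtain c C where c: "c > 0" "C \<ge> 0" "\<eta> \<in> borel_measurable (lebesgue_on \<Omega>)"
    "AE x in lebesgue_on \<Omega>. c \<le> \<eta> x" "AE x in lebesgue_on \<Omega>. \<bar>\<eta> x\<bar> \<le> C"
    by (rule Linf_plusE[OF assms(2)])
  have "0 \<le> c * (l2_norm \<Omega> v)\<^sup>2" using c(1) by simp
  also have "\<dots> \<le> l2_inner \<Omega> (weighted \<eta> v) v" by (rule weighted_coercive[OF assms c(4)])
  finally show ?thesis .
qed

lemma eta_norm_sq:
  assumes "v \<in> L2 \<Omega>" "\<eta> \<in> Linf_plus \<Omega>"
  shows "(eta_norm \<Omega> \<eta> v)\<^sup>2 = l2_inner \<Omega> (weighted \<eta> v) v"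
  by (simp add: eta_norm_def weighted_inner_self_nonneg[OF assms])

lemma weighted_inner_scaleR_left:
  "l2_inner \<Omega> (weighted \<eta> (\<lambda>x. c *\<^sub>R u x)) v = c * l2_inner \<Omega> (weighted \<eta> u) v"
  using l2_inner_scaleR_left[of \<Omega> c "weighted \<eta> u" v]
  by (simp add: weighted_def mult.commute)

lemma weighted_inner_diff_left:
  assumes "\<eta> \<in> Linf_plus \<Omega>" "u \<in> L2 \<Omega>" "v \<in> L2 \<Omega>" "w \<in> L2 \<Omega>"
  shows "l2_inner \<Omega> (weighted \<eta> (\<lambda>x. u x - v x)) w = l2_inner \<Omega> (weighted \<eta> u) w - l2_inner \<Omega> (weighted \<eta> v) w"
  using l2_inner_diff_left[OF weighted_L2 weighted_L2, of \<eta> \<Omega> u \<eta> v w] assms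
  by (simp add: weighted_def scaleR_diff_right)

lemma weighted_inner_sum_left:
  assumes "\<eta> \<in> Linf_plus \<Omega>" "\<And>k. k \<in> I \<Longrightarrow> f k \<in> L2 \<Omega>" "v \<in> L2 \<Omega>"
  shows "l2_inner \<Omega> (weighted \<eta> (\<lambda>x. \<Sum>k\<in>I. c k *\<^sub>R f k x)) v = (\<Sum>k\<in>I. c k * l2_inner \<Omega> (weighted \<eta> (f k)) v)"
proof -
  have eq: "weighted \<eta> (\<lambda>x. \<Sum>k\<in>I. c k *\<^sub>R f k x) = (\<lambda>x. \<Sum>k\<in>I. c k *\<^sub>R weighted \<eta> (f k) x)"
    by (simp add: weighted_def scaleR_sum_right mult.commute)
  show ?thesis
    unfolding eq l2_inner_scaleR_left[symmetric]
    using assms by (intro l2_inner_sum_left L2_scaleR weighted_L2)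
qed

locale weighted_orthonormal =
  fixes \<Omega> :: "(real^3) set" and \<eta> :: "real^3 \<Rightarrow> real" and e :: "nat \<Rightarrow> real^3 \<Rightarrow> real^3"
  assumes \<Omega>: "\<Omega> \<in> lmeasurable" "bounded \<Omega>"
    and \<eta>: "\<eta> \<in> Linf_plus \<Omega>"
    and e_L2: "k \<ge> 1 \<Longrightarrow> e k \<in> L2 \<Omega>"
    and orthonormal: "m \<ge> 1 \<Longrightarrow> n \<ge> 1 \<Longrightarrow> l2_inner \<Omega> (weighted \<eta> (e m)) (e n) = (if m = n then 1 else 0)"
begin

definition fourier :: "(real^3 \<Rightarrow> real^3) \<Rightarrow> nat \<Rightarrow> real" where
  "fourier v k = l2_inner \<Omega> (weighted \<eta> v) (e k)"

definition residual :: "(real^3 \<Rightarrow> real^3) \<Rightarrow> nat \<Rightarrow> real^3 \<Rightarrow> real^3" where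
  "residual v N = (\<lambda>x. v x - (\<Sum>k=1..N. fourier v k *\<^sub>R e k x))"

lemma combination_L2: "I \<subseteq> {1..} \<Longrightarrow> (\<lambda>x. \<Sum>k\<in>I. c k *\<^sub>R e k x) \<in> L2 \<Omega>"
  by (intro L2_sum L2_scaleR e_L2) auto

lemma inner_combination:
  assumes "I \<subseteq> {1..}" "u \<in> L2 \<Omega>"
  shows "l2_inner \<Omega> (weighted \<eta> (\<lambda>x. \<Sum>k\<in>I. c k *\<^sub>R e k x)) u = (\<Sum>k\<in>I. c k * fourier u k)"
  using assms by (subst weighted_inner_sum_left[OF \<eta>]) (auto simp: fourier_def weighted_inner_commute[of _ _ u] simp del: One_nat_def intro: e_L2)

lemma fourier_combination:
  assumes "I \<subseteq> {1..}" "finite I" "n \<ge> 1"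
  shows "fourier (\<lambda>x. \<Sum>k\<in>I. c k *\<^sub>R e k x) n = (if n \<in> I then c n else 0)"
proof -
  have "fourier (\<lambda>x. \<Sum>k\<in>I. c k *\<^sub>R e k x) n = (\<Sum>k\<in>I. c k * fourier (e n) k)"
    unfolding fourier_def[of "\<lambda>x. \<Sum>k\<in>I. c k *\<^sub>R e k x"] by (rule inner_combination[OF assms(1) e_L2[OF assms(3)]])
  also have "\<dots> = (\<Sum>k\<in>I. if k = n then c k else 0)"
    using assms by (intro sum.cong) (auto simp: fourier_def orthonormal)
  finally show ?thesis using assms(2) by simp
qed

lemma norm_combination:
  assumes "I \<subseteq> {1..}" "finite I"
  shows "l2_inner \<Omega> (weighted \<eta> (\<lambda>x. \<Sum>k\<in>I. c k *\<^sub>R e k x)) (\<lambda>x. \<Sum>k\<in>I. c k *\<^sub>R e k x) = (\<Sum>k\<in>I. (c k)\<^sup>2)"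
proof -
  have "l2_inner \<Omega> (weighted \<eta> (\<lambda>x. \<Sum>k\<in>I. c k *\<^sub>R e k x)) (\<lambda>x. \<Sum>k\<in>I. c k *\<^sub>R e k x)
    = (\<Sum>k\<in>I. c k * fourier (\<lambda>x. \<Sum>k\<in>I. c k *\<^sub>R e k x) k)"
    by (intro inner_combination combination_L2 assms)
  also have "\<dots> = (\<Sum>k\<in>I. (c k)\<^sup>2)"
  proof (rule sum.cong[OF refl])
    fix k assume "k \<in> I"
    then have "k \<ge> 1" using assms(1) by auto
    then show "c k * fourier (\<lambda>x. \<Sum>k\<in>I. c k *\<^sub>R e k x) k = (c k)\<^sup>2"
      using fourier_combination[OF assms, of k c] \<open>k \<in> I\<close> by (simp add: power2_eq_square)
  qed
  finally show ?thesis .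
qed

lemma residual_L2: "v \<in> L2 \<Omega> \<Longrightarrow> residual v N \<in> L2 \<Omega>"
  unfolding residual_def by (intro L2_diff combination_L2) auto

lemma fourier_residual:
  assumes "v \<in> L2 \<Omega>" "n \<in> {1..N}"
  shows "fourier (residual v N) n = 0"
proof -
  have "fourier (residual v N) n = fourier v n - fourier (\<lambda>x. \<Sum>k=1..N. fourier v k *\<^sub>R e k x) n"
    unfolding residual_def fourier_def[of _ n]
    by (rule weighted_inner_diff_left[OF \<eta> assms(1) combination_L2 e_L2]) (use assms(2) in auto)
  also have "fourier (\<lambda>x. \<Sum>k=1..N. fourier v k *\<^sub>R e k x) n = fourier v n"
    using assms(2) by (subst fourier_combination) auto
  finally show ?thesis by simp
qed

text \<open>Pythagoras: the residual is orthogonal to the Fourier sum that was subtracted.\<close>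

lemma norm_residual:
  assumes v: "v \<in> L2 \<Omega>"
  shows "l2_inner \<Omega> (weighted \<eta> (residual v N)) (residual v N) 
    = l2_inner \<Omega> (weighted \<eta> v) v - (\<Sum>k=1..N. (fourier v k)\<^sup>2)"
proof -
  let ?s = "\<lambda>x. \<Sum>k=1..N. fourier v k *\<^sub>R e k x"
  have s: "?s \<in> L2 \<Omega>" by (rule combination_L2) auto
  note r = residual_L2[OF v, of N]
  have "l2_inner \<Omega> (weighted \<eta> (residual v N)) (residual v N) 
    = l2_inner \<Omega> (weighted \<eta> v) (residual v N) - l2_inner \<Omega> (weighted \<eta> ?s) (residual v N)"
    using weighted_inner_diff_left[OF \<eta> v s r] by (simp only: residual_def)
  also have "l2_inner \<Omega> (weighted \<eta> ?s) (residual v N) = 0"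
    using v r by (subst inner_combination) (auto simp: fourier_residual)
  also have "l2_inner \<Omega> (weighted \<eta> v) (residual v N) = l2_inner \<Omega> (weighted \<eta> (residual v N)) v"
    by (rule weighted_inner_commute)
  also have "\<dots> = l2_inner \<Omega> (weighted \<eta> v) v - l2_inner \<Omega> (weighted \<eta> ?s) v"
    using weighted_inner_diff_left[OF \<eta> v s v] by (simp only: residual_def)
  also have "l2_inner \<Omega> (weighted \<eta> ?s) v = (\<Sum>k=1..N. (fourier v k)\<^sup>2)"
    using v by (subst inner_combination) (auto simp: power2_eq_square)
  finally show ?thesis by simp
qed

lemma Bessel_inequality:
  assumes "v \<in> L2 \<Omega>"
  shows "(\<Sum>k=1..N. (fourier v k)\<^sup>2) \<le> l2_inner \<Omega> (weighted \<eta> v) v"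
  using norm_residual[OF assms, of N] weighted_inner_self_nonneg[OF residual_L2[OF assms] \<eta>, of N] by simp

text \<open>The Bessel sums \<open>S\<close> are increasing and bounded, hence Cauchy. Two residuals
  differ by a block of the Fourier series whose squared weighted norm is the increment of
  \<open>S\<close>, and coercivity transfers this to the plain norm.\<close>

lemma residual_convergent:
  assumes v: "v \<in> L2 \<Omega>"
  obtains r where "r \<in> L2 \<Omega>" "(\<lambda>N. l2_norm \<Omega> (\<lambda>x. residual v N x - r x)) \<longlonglongrightarrow> 0"
proof -
  obtain c C where c: "c > 0" "C \<ge> 0" "\<eta> \<in> borel_measurable (lebesgue_on \<Omega>)"
    "AE x in lebesgue_on \<Omega>. c \<le> \<eta> x" "AE x in lebesgue_on \<Omega>. \<bar>\<eta> x\<bar> \<le> C"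
    by (rule Linf_plusE[OF \<eta>])
  define S where "S N = (\<Sum>k=1..N. (fourier v k)\<^sup>2)" for N
  have "incseq S" unfolding S_def by (intro incseq_SucI) simp
  moreover have "S N \<le> l2_inner \<Omega> (weighted \<eta> v) v" for N
    unfolding S_def by (rule Bessel_inequality[OF v])
  ultimately obtain L where "S \<longlonglongrightarrow> L"
    using incseq_convergent[of S] by blast
  then have S: "Cauchy S" by (rule LIMSEQ_imp_Cauchy)
  have le: "c * (l2_norm \<Omega> (\<lambda>x. residual v M x - residual v N x))\<^sup>2 \<le> S N - S M" if "M \<le> N" for M N
  proof -
    let ?t = "\<lambda>x. \<Sum>k\<in>{M<..N}. fourier v k *\<^sub>R e k x"
    have "(\<lambda>x. residual v M x - residual v N x) = ?t"
      unfolding residual_def sum_split_at[OF that] by simp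
    moreover have "?t \<in> L2 \<Omega>" by (rule combination_L2) auto
    ultimately have "c * (l2_norm \<Omega> (\<lambda>x. residual v M x - residual v N x))\<^sup>2 \<le> l2_inner \<Omega> (weighted \<eta> ?t) ?t"
      using weighted_coercive[OF _ \<eta> c(4)] by simp
    also have "\<dots> = (\<Sum>k\<in>{M<..N}. (fourier v k)\<^sup>2)" by (rule norm_combination) auto
    also have "\<dots> = S N - S M"
      unfolding S_def sum_split_at[OF that] by simp
    finally show ?thesis .
  qed
  have le': "c * (l2_norm \<Omega> (\<lambda>x. residual v M x - residual v N x))\<^sup>2 \<le> \<bar>S M - S N\<bar>" for M N
  proof (cases "M \<le> N")
    case True
    then show ?thesis using le[of M N] by simp
  next
    case False
    then show ?thesis using le[of N M] l2_norm_minus_commute[of \<Omega> "residual v M" "residual v N"] by simp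
  qed
  show thesis
  proof (rule L2_complete[OF \<Omega>(1) residual_L2[OF v]])
    fix \<epsilon> :: real assume "\<epsilon> > 0"
    then have "c * \<epsilon>\<^sup>2 > 0" using c by simp
    from CauchyD[OF S this]
    obtain N where N: "\<And>m n. m \<ge> N \<Longrightarrow> n \<ge> N \<Longrightarrow> norm (S m - S n) < c * \<epsilon>\<^sup>2"
      by blast
    have "l2_norm \<Omega> (\<lambda>x. residual v i x - residual v k x) < \<epsilon>" if "i \<ge> N" "k \<ge> N" for i k
    proof -
      have "c * (l2_norm \<Omega> (\<lambda>x. residual v i x - residual v k x))\<^sup>2 < c * \<epsilon>\<^sup>2"
        using le'[of i k] N[OF that] by simp
      then show ?thesis
        using c(1) \<open>\<epsilon> > 0\<close> power2_less_imp_less[of "l2_norm \<Omega> (\<lambda>x. residual v i x - residual v k x)" \<epsilon>] by simp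
    qed
    then show "\<exists>N. \<forall>i\<ge>N. \<forall>k\<ge>N. l2_norm \<Omega> (\<lambda>x. residual v i x - residual v k x) < \<epsilon>"
      by blast
  qed (use that in blast)
qed

end

section \<open>Decay of the images of an orthonormal system and the limit of the residuals\<close>

lemma l2_inner_cong:
  "(\<And>x. x \<in> \<Omega> \<Longrightarrow> u x = u' x) \<Longrightarrow> l2_inner \<Omega> u v = l2_inner \<Omega> u' v"
  unfolding l2_inner_def by (rule Bochner_Integration.integral_cong) auto

lemma l2_norm_AE_zero:
  assumes "v \<in> borel_measurable (lebesgue_on \<Omega>)" "AE x in lebesgue_on \<Omega>. v x = 0"
  shows "l2_norm \<Omega> v = 0"
proof -
  have "l2_inner \<Omega> v v = l2_inner \<Omega> (\<lambda>x. 0) v"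
    by (rule l2_inner_cong_AE) (use assms in auto)
  then show ?thesis by (simp add: l2_norm_def l2_inner_zero_left)
qed

lemma norm_sq_eq_sum_Basis:
  fixes a :: "'a::euclidean_space"
  shows "(norm a)\<^sup>2 = (\<Sum>b\<in>Basis. (a \<bullet> b)\<^sup>2)"
  unfolding power2_norm_eq_inner by (subst euclidean_inner) (simp add: power2_eq_square)

context weighted_orthonormal
begin

text \<open>The system is orthonormal for the weighted product, while these coefficients use the
  plain one. The field h / \<eta> represents the same functional in the weighted product, and its
  squared weighted norm, the integral of |h|^2 / \<eta>, is at most the right-hand side.\<close>

lemma sum_inner_sq_le:
  assumes h: "h \<in> L2 \<Omega>" and c: "c > 0" "AE x in lebesgue_on \<Omega>. c \<le> \<eta> x"
  shows "(\<Sum>k=1..N. (l2_inner \<Omega> h (e k))\<^sup>2) \<le> (l2_norm \<Omega> h)\<^sup>2 / c"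
proof -
  have [measurable]: "\<eta> \<in> borel_measurable (lebesgue_on \<Omega>)"
    using \<eta> by (simp add: Linf_plus_def)
  note [measurable] = L2_measurable[OF h]
  define u where "u x = (1 / \<eta> x) *\<^sub>R h x" for x
  have um[measurable]: "u \<in> borel_measurable (lebesgue_on \<Omega>)"
    unfolding u_def by (intro borel_measurable_scaleR borel_measurable_divide borel_measurable_const) simp_all
  have u: "u \<in> L2 \<Omega>"
  proof (rule L2_bound[OF h um])
    show "AE x in lebesgue_on \<Omega>. norm (u x) \<le> (1 / c) * norm (h x)"
      using c(2)
    proof eventually_elim
      case (elim x)
      then have "\<bar>1 / \<eta> x\<bar> \<le> 1 / c" using c(1) by (simp add: frac_le)
      then show ?case by (simp add: u_def mult_right_mono del: times_divide_eq_left)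
    qed
  qed
  have eq: "AE x in lebesgue_on \<Omega>. weighted \<eta> u x = h x"
    using c(2) by eventually_elim (use c(1) in \<open>simp add: weighted_def u_def\<close>)
  have wm: "weighted \<eta> u \<in> borel_measurable (lebesgue_on \<Omega>)"
    by (rule L2_measurable[OF weighted_L2[OF \<eta> u]])
  have coef: "fourier u k = l2_inner \<Omega> h (e k)" if "k \<ge> 1" for k
    unfolding fourier_def
    by (rule l2_inner_cong_AE[OF wm L2_measurable[OF h] L2_measurable[OF e_L2[OF that]] eq])
  have "(\<Sum>k=1..N. (l2_inner \<Omega> h (e k))\<^sup>2) = (\<Sum>k=1..N. (fourier u k)\<^sup>2)"
    by (rule sum.cong) (simp_all add: coef)
  also have "\<dots> \<le> l2_inner \<Omega> (weighted \<eta> u) u"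
    by (rule Bessel_inequality[OF u])
  also have "\<dots> = l2_inner \<Omega> h u"
    by (rule l2_inner_cong_AE[OF wm L2_measurable[OF h] um eq])
  also have "\<dots> \<le> (LINT x|lebesgue_on \<Omega>. (1 / c) * (h x \<bullet> h x))"
    unfolding l2_inner_def
  proof (rule integral_mono_AE)
    show "integrable (lebesgue_on \<Omega>) (\<lambda>x. h x \<bullet> u x)" "integrable (lebesgue_on \<Omega>) (\<lambda>x. (1 / c) * (h x \<bullet> h x))"
      by (intro integrable_mult_right L2_integrable_inner h u)+
    show "AE x in lebesgue_on \<Omega>. h x \<bullet> u x \<le> (1 / c) * (h x \<bullet> h x)"
      using c(2)
    proof eventually_elim
      case (elim x)
      then have "1 / \<eta> x \<le> 1 / c" using c(1) by (simp add: frac_le)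
      then have "(1 / \<eta> x) * (h x \<bullet> h x) \<le> (1 / c) * (h x \<bullet> h x)" by (rule mult_right_mono) simp
      then show ?case by (simp add: u_def)
    qed
  qed
  also have "\<dots> = (l2_norm \<Omega> h)\<^sup>2 / c"
    by (simp only: integral_mult_right_zero l2_norm_sq l2_inner_def) simp
  finally show ?thesis .
qed

text \<open>
  For fixed \<open>x\<close> the components of \<open>A_op \<mu> \<Omega> (e k) x\<close> are inner products of \<open>e k\<close> with the fixed
  square integrable field \<open>y \<mapsto> b / norm (x - y)\<close>, so Bessel's inequality bounds the sum of their squares
  uniformly in \<open>x\<close>. This replaces the compactness of the operator.
\<close>
lemma A_op_tendsto_zero:
  assumes "\<mu> > 0"
  shows "(\<lambda>k. l2_norm \<Omega> (A_op \<mu> \<Omega> (e k))) \<longlonglongrightarrow> 0"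
proof -
  obtain c C where c: "c > 0" "C \<ge> 0" "\<eta> \<in> borel_measurable (lebesgue_on \<Omega>)"
    "AE x in lebesgue_on \<Omega>. c \<le> \<eta> x" "AE x in lebesgue_on \<Omega>. \<bar>\<eta> x\<bar> \<le> C"
    by (rule Linf_plusE[OF \<eta>])
  obtain B where B: "B \<ge> 0" "\<And>x. x \<in> \<Omega> \<Longrightarrow> (\<lambda>y. 1 / norm (x - y)) \<in> L2 \<Omega>"
    "\<And>x. x \<in> \<Omega> \<Longrightarrow> l2_norm \<Omega> (\<lambda>y. 1 / norm (x - y)) \<le> B"
    using newton_kernel_L2[OF fmeasurableD[OF \<Omega>(1)] \<Omega>(2)] by blast
  note A = A_op_L2[OF \<Omega> \<open>\<mu> > 0\<close>]
  \<comment> \<open>Each Cartesian component of the kernel row contributes B^2 / c by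
    \<open>sum_inner_sq_le\<close>; the first factor is the square of the constant in front of the
    integral.\<close>
  define D where "D = (\<mu> / (4 * pi))\<^sup>2 * (real (card (Basis :: (real^3) set)) * (B\<^sup>2 / c))"
  have pointwise: "(\<Sum>k=1..N. (norm (A_op \<mu> \<Omega> (e k) x))\<^sup>2) \<le> D" if x: "x \<in> \<Omega>" for x N
  proof -
    let ?I = "\<lambda>k. LINT y|lebesgue_on \<Omega>. (1 / norm (x - y)) *\<^sub>R e k y"
    have comp: "(\<Sum>k=1..N. (?I k \<bullet> b)\<^sup>2) \<le> B\<^sup>2 / c" if b: "b \<in> Basis" for b
    proof -
      let ?h = "\<lambda>y. (1 / norm (x - y)) *\<^sub>R b"
      have h: "?h \<in> L2 \<Omega>"
        by (rule L2_bound[OF B(2)[OF x], where C = 1]) (use b in auto)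
      have "?I k \<bullet> b = l2_inner \<Omega> ?h (e k)" if "k \<ge> 1" for k
      proof -
        have "?I k \<bullet> b = (LINT y|lebesgue_on \<Omega>. ((1 / norm (x - y)) *\<^sub>R e k y) \<bullet> b)"
          using A_op_integrable[OF B(2)[OF x] e_L2[OF that]] by (intro integral_inner_left[symmetric])
        then show ?thesis by (simp add: l2_inner_def inner_commute)
      qed
      then have "(\<Sum>k=1..N. (?I k \<bullet> b)\<^sup>2) = (\<Sum>k=1..N. (l2_inner \<Omega> ?h (e k))\<^sup>2)"
        by (intro sum.cong) auto
      also have "\<dots> \<le> (l2_norm \<Omega> ?h)\<^sup>2 / c"
        by (rule sum_inner_sq_le[OF h c(1,4)])
      also have "l2_norm \<Omega> ?h = l2_norm \<Omega> (\<lambda>y. 1 / norm (x - y))"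
        using b by (simp add: l2_norm_def l2_inner_def inner_Basis)
      also have "(l2_norm \<Omega> (\<lambda>y. 1 / norm (x - y)))\<^sup>2 / c \<le> B\<^sup>2 / c"
        using c(1) by (intro divide_right_mono power_mono B x l2_norm_nonneg) auto
      finally show ?thesis .
    qed
    have "(\<Sum>k=1..N. (norm (?I k))\<^sup>2) = (\<Sum>k=1..N. \<Sum>b\<in>Basis. (?I k \<bullet> b)\<^sup>2)"
      by (intro sum.cong refl norm_sq_eq_sum_Basis)
    also have "\<dots> = (\<Sum>b\<in>Basis. \<Sum>k=1..N. (?I k \<bullet> b)\<^sup>2)" by (rule sum.swap)
    also have "\<dots> \<le> (\<Sum>b\<in>(Basis :: (real^3) set). B\<^sup>2 / c)" by (intro sum_mono comp)
    also have "\<dots> = real (card (Basis :: (real^3) set)) * (B\<^sup>2 / c)" by (rule sum_constant)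
    finally have "(\<mu> / (4 * pi))\<^sup>2 * (\<Sum>k=1..N. (norm (?I k))\<^sup>2) \<le> D"
      unfolding D_def by (intro mult_left_mono) auto
    then show ?thesis
      unfolding A_op_def by (simp only: norm_scaleR power_mult_distrib sum_distrib_left power2_abs)
  qed
  interpret finite_measure "lebesgue_on \<Omega>"
    using \<Omega>(1) by (rule finite_measure_lebesgue_on)
  let ?a = "\<lambda>k. (l2_norm \<Omega> (A_op \<mu> \<Omega> (e k)))\<^sup>2"
  have "(\<Sum>k=1..N. ?a k) \<le> D * measure (lebesgue_on \<Omega>) \<Omega>" for N
  proof -
    have i: "integrable (lebesgue_on \<Omega>) (\<lambda>x. (norm (A_op \<mu> \<Omega> (e k) x))\<^sup>2)" if "k \<in> {1..N}" for k
      using that by (intro L2_integrable_norm_sq A e_L2) auto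
    have "(\<Sum>k=1..N. ?a k) = (\<Sum>k=1..N. (LINT x|lebesgue_on \<Omega>. (norm (A_op \<mu> \<Omega> (e k) x))\<^sup>2))"
      by (simp only: l2_norm_sq l2_inner_def dot_square_norm)
    also have "\<dots> = (LINT x|lebesgue_on \<Omega>. (\<Sum>k=1..N. (norm (A_op \<mu> \<Omega> (e k) x))\<^sup>2))"
      by (rule Bochner_Integration.integral_sum[symmetric, OF i])
    also have "\<dots> \<le> (LINT x|lebesgue_on \<Omega>. D)"
      by (intro integral_mono Bochner_Integration.integrable_sum i pointwise) auto
    finally show ?thesis by (simp add: mult.commute)
  qed
  \<comment> \<open>The shift skips \<open>e 0\<close>, about which nothing is assumed; the limit is
    unaffected.\<close>
  then have bound: "(\<Sum>k<N. ?a (Suc k)) \<le> D * measure (lebesgue_on \<Omega>) \<Omega>" for N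
    by (simp only: sum.atLeast1_atMost_eq[of ?a, symmetric] One_nat_def)
  have "summable (\<lambda>k. ?a (Suc k))"
    by (rule summableI_nonneg_bounded[OF _ bound]) simp
  then have "(\<lambda>k. ?a (Suc k)) \<longlonglongrightarrow> 0" by (rule summable_LIMSEQ_zero)
  then have "?a \<longlonglongrightarrow> 0" by (rule LIMSEQ_imp_Suc)
  then have "(\<lambda>k. sqrt (?a k)) \<longlonglongrightarrow> sqrt 0" by (rule tendsto_real_sqrt)
  then show ?thesis by (simp add: l2_norm_nonneg)
qed

text \<open>Boundedness of A makes the energy continuous in the mean square, so the limit of the
  residuals has energy at most 0 and is null by positive definiteness.\<close>

lemma residual_limit_zero:
  assumes "\<mu> > 0" and v: "v \<in> L2 \<Omega>" 
    and en: "\<And>N. l2_inner \<Omega> (A_op \<mu> \<Omega> (residual v N)) (residual v N) \<le> t N" "t \<longlonglongrightarrow> 0"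
  shows "(\<lambda>N. l2_norm \<Omega> (residual v N)) \<longlonglongrightarrow> 0"
proof -
  obtain r where r: "r \<in> L2 \<Omega>" "(\<lambda>N. l2_norm \<Omega> (\<lambda>x. residual v N x - r x)) \<longlonglongrightarrow> 0"
    by (rule residual_convergent[OF v])
  obtain C where C: "C \<ge> 0" and A: "\<And>v. v \<in> L2 \<Omega> \<Longrightarrow> A_op \<mu> \<Omega> v \<in> L2 \<Omega>"
    and AC: "\<And>v. v \<in> L2 \<Omega> \<Longrightarrow> l2_norm \<Omega> (A_op \<mu> \<Omega> v) \<le> C * l2_norm \<Omega> v"
    using A_op_bounded[OF \<Omega> \<open>\<mu> > 0\<close>] by blast
  obtain B where B: "B \<ge> 0" "\<And>x. x \<in> \<Omega> \<Longrightarrow> (\<lambda>y. 1 / norm (x - y)) \<in> L2 \<Omega>"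
    "\<And>x. x \<in> \<Omega> \<Longrightarrow> l2_norm \<Omega> (\<lambda>y. 1 / norm (x - y)) \<le> B"
    using newton_kernel_L2[OF fmeasurableD[OF \<Omega>(1)] \<Omega>(2)] by blast
  define d where "d N = l2_norm \<Omega> (\<lambda>x. residual v N x - r x)" for N
  let ?R = "l2_norm \<Omega> r"
  have norm_le: "l2_norm \<Omega> (residual v N) \<le> d N + ?R" for N
    using l2_norm_triangle[OF L2_diff[OF residual_L2[OF v] r(1)] r(1), of N] by (simp add: d_def)
  have inner_le: "l2_inner \<Omega> (A_op \<mu> \<Omega> u) w \<ge> - (C * l2_norm \<Omega> u * l2_norm \<Omega> w)" 
    if "u \<in> L2 \<Omega>" "w \<in> L2 \<Omega>" for u w
  proof -
    have "\<bar>l2_inner \<Omega> (A_op \<mu> \<Omega> u) w\<bar> \<le> l2_norm \<Omega> (A_op \<mu> \<Omega> u) * l2_norm \<Omega> w"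
      by (intro l2_Cauchy_Schwarz A that)
    also have "\<dots> \<le> C * l2_norm \<Omega> u * l2_norm \<Omega> w"
      by (intro mult_right_mono AC that l2_norm_nonneg)
    finally show ?thesis by linarith
  qed
  \<comment> \<open>With z = s - r one has <A r, r> = <A s, s> - <A z, s> - <A r, z>; the last two
    terms are controlled by the norm \<open>d N\<close> of z.\<close>
  have "l2_inner \<Omega> (A_op \<mu> \<Omega> r) r \<le> t N + C * d N * (d N + ?R) + C * ?R * d N" for N
  proof -
    let ?s = "residual v N"
    let ?z = "\<lambda>x. ?s x - r x"
    have s: "?s \<in> L2 \<Omega>" and z: "?z \<in> L2 \<Omega>"
      using residual_L2[OF v] r(1) by (auto intro: L2_diff)
    have "l2_inner \<Omega> (A_op \<mu> \<Omega> ?z) ?s = l2_inner \<Omega> (\<lambda>x. A_op \<mu> \<Omega> ?s x - A_op \<mu> \<Omega> r x) ?s"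
      by (rule l2_inner_cong) (rule A_op_diff[OF B(2) s r(1)])
    also have "\<dots> = l2_inner \<Omega> (A_op \<mu> \<Omega> ?s) ?s - l2_inner \<Omega> (A_op \<mu> \<Omega> r) ?s"
      by (intro l2_inner_diff_left A s r)
    finally have 1: "l2_inner \<Omega> (A_op \<mu> \<Omega> ?z) ?s = l2_inner \<Omega> (A_op \<mu> \<Omega> ?s) ?s - l2_inner \<Omega> (A_op \<mu> \<Omega> r) ?s" .
    have 2: "l2_inner \<Omega> (A_op \<mu> \<Omega> r) ?z = l2_inner \<Omega> (A_op \<mu> \<Omega> r) ?s - l2_inner \<Omega> (A_op \<mu> \<Omega> r) r"
      by (intro l2_inner_diff_right A s r)
    have "C * d N * l2_norm \<Omega> ?s \<le> C * d N * (d N + ?R)"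
      using C by (intro mult_left_mono norm_le mult_nonneg_nonneg) (auto simp: d_def l2_norm_nonneg)
    with inner_le[OF z s] have 3: "l2_inner \<Omega> (A_op \<mu> \<Omega> ?z) ?s \<ge> - (C * d N * (d N + ?R))"
      by (simp add: d_def)
    have 4: "l2_inner \<Omega> (A_op \<mu> \<Omega> r) ?z \<ge> - (C * ?R * d N)"
      using inner_le[OF r(1) z] by (simp add: d_def)
    from 1 2 3 4 en(1)[of N] show ?thesis by linarith
  qed
  note le = this
  have lim: "(\<lambda>N. t N + C * d N * (d N + ?R) + C * ?R * d N) \<longlonglongrightarrow> 0 + C * 0 * (0 + ?R) + C * ?R * 0"
    using r(2) unfolding d_def by (intro tendsto_intros en(2))
  have "l2_inner \<Omega> (A_op \<mu> \<Omega> r) r \<le> 0 + C * 0 * (0 + ?R) + C * ?R * 0"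
    by (rule LIMSEQ_le_const[OF lim]) (intro exI allI impI le)
  then have "l2_inner \<Omega> (A_op \<mu> \<Omega> r) r \<le> 0" by simp
  then have "AE x in lebesgue_on \<Omega>. r x = 0"
    by (rule A_op_positive_definite[OF \<Omega> \<open>\<mu> > 0\<close> r(1)])
  then have R: "?R = 0" by (rule l2_norm_AE_zero[OF L2_measurable[OF r(1)]])
  have lim: "(\<lambda>N. d N + ?R) \<longlonglongrightarrow> 0"
    using r(2) by (simp add: R d_def)
  show ?thesis
    by (rule tendsto_sandwich[OF always_eventually always_eventually tendsto_const lim])
       (intro allI l2_norm_nonneg norm_le)+
qed

end

section \<open>The maximizers: orthonormality, decay of the maxima, convergence of Fourier
  series\<close>

theorem proposition3p5:
  fixes \<Omega> :: "(real^3) set" and \<mu>\<^sub>0 :: real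
    and \<eta> :: "real^3 \<Rightarrow> real" and j :: "nat \<Rightarrow> real^3 \<Rightarrow> real^3"
  assumes "bounded_lipschitz_domain \<Omega>"
    and "\<mu>\<^sub>0 > 0"
    and "\<eta> \<in> Linf_plus \<Omega>"
    and "maximizer_sequence \<mu>\<^sub>0 \<Omega> \<eta> j"
  shows "complete_basis_HL \<Omega> \<eta> j"
proof -
  note \<eta> = assms(3)
  have \<Omega>: "\<Omega> \<in> lmeasurable" "bounded \<Omega>"
    using assms(1) by (auto simp: bounded_lipschitz_domain_def intro: lmeasurable_open)
  have max: "is_arg_max (\<lambda>v. l2_inner \<Omega> (A_op \<mu>\<^sub>0 \<Omega> v) v)
      (\<lambda>v. v \<in> HLn \<Omega> \<eta> j n \<and> eta_norm \<Omega> \<eta> v = 1) (j n)" if "n \<ge> 1" for n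
    using assms(4) that by (simp add: maximizer_sequence_def)
  have j: "j n \<in> HLn \<Omega> \<eta> j n" "eta_norm \<Omega> \<eta> (j n) = 1" if "n \<ge> 1" for n
    using max[OF that] by (auto simp: is_arg_max_def)
  have HL: "j n \<in> HL \<Omega>" if "n \<ge> 1" for n
    using j[OF that] by (simp add: HLn_def)
  have L2: "j n \<in> L2 \<Omega>" if "n \<ge> 1" for n
    using HL[OF that] by (rule HL_L2)
  \<comment> \<open>The constraints of a problem concern earlier indices only; symmetry of the
    weighted product supplies the other order.\<close>
  have orth: "l2_inner \<Omega> (weighted \<eta> (j n)) (j m) = 0" if "1 \<le> m" "m < n" for m n
    using j(1)[of n] that by (simp add: HLn_def weighted_inner_move)
  interpret weighted_orthonormal \<Omega> \<eta> j
  proof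
    fix m n :: nat assume mn: "m \<ge> 1" "n \<ge> 1"
    consider "m < n" | "n < m" | "m = n" by linarith
    then show "l2_inner \<Omega> (weighted \<eta> (j m)) (j n) = (if m = n then 1 else 0)"
    proof cases
      case 1
      then show ?thesis using orth[OF mn(1) 1] by (simp add: weighted_inner_commute[of _ _ "j m"])
    next
      case 2
      then show ?thesis using orth[OF mn(2) 2] by simp
    next
      case 3
      then show ?thesis using eta_norm_sq[OF L2[OF mn(1)] \<eta>] j(2)[OF mn(1)] by simp
    qed
  qed (use \<Omega> \<eta> L2 in auto)
  obtain c C where c: "c > 0" "C \<ge> 0" "\<eta> \<in> borel_measurable (lebesgue_on \<Omega>)"
    "AE x in lebesgue_on \<Omega>. c \<le> \<eta> x" "AE x in lebesgue_on \<Omega>. \<bar>\<eta> x\<bar> \<le> C"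
    by (rule Linf_plusE[OF \<eta>])
  note A = A_op_L2[OF \<Omega> \<open>\<mu>\<^sub>0 > 0\<close>]
  \<comment> \<open>This is an upper bound for the maximum of problem \<open>n\<close>:
    Cauchy-Schwarz combined with the coercivity bound sqrt (1 / c) on the plain norm of
    \<open>j n\<close>.\<close>
  define \<tau> where "\<tau> n = l2_norm \<Omega> (A_op \<mu>\<^sub>0 \<Omega> (j n)) * sqrt (1 / c)" for n
  have \<tau>_nonneg: "\<tau> n \<ge> 0" for n
    using c(1) by (simp add: \<tau>_def l2_norm_nonneg)
  have \<tau>: "l2_inner \<Omega> (A_op \<mu>\<^sub>0 \<Omega> (j n)) (j n) \<le> \<tau> n" if n: "n \<ge> 1" for n
  proof -
    have "c * (l2_norm \<Omega> (j n))\<^sup>2 \<le> 1"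
      using weighted_coercive[OF L2[OF n] \<eta> c(4)] orthonormal[OF n n] by simp
    then have "l2_norm \<Omega> (j n) \<le> sqrt (1 / c)"
      using c(1) by (intro real_le_rsqrt) (simp add: field_simps)
    then have "l2_norm \<Omega> (A_op \<mu>\<^sub>0 \<Omega> (j n)) * l2_norm \<Omega> (j n) \<le> \<tau> n"
      unfolding \<tau>_def by (intro mult_left_mono l2_norm_nonneg)
    then show ?thesis
      using l2_Cauchy_Schwarz[OF A[OF L2[OF n]] L2[OF n]] by linarith
  qed
  have "\<tau> \<longlonglongrightarrow> 0"
    unfolding \<tau>_def using tendsto_mult_right[OF A_op_tendsto_zero[OF \<open>\<mu>\<^sub>0 > 0\<close>], of "sqrt (1 / c)"] by simp
  \<comment> \<open>Homogeneous form of the maximum property. If the weighted norm of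
    \<open>w\<close> vanishes, coercivity makes both sides trivial; otherwise \<open>w\<close> is
    scaled to unit weighted norm and compared with \<open>j n\<close>.\<close>
  have energy: "l2_inner \<Omega> (A_op \<mu>\<^sub>0 \<Omega> w) w \<le> \<tau> n * l2_inner \<Omega> (weighted \<eta> w) w"
    if n: "n \<ge> 1" and w: "w \<in> HLn \<Omega> \<eta> j n" for n w
  proof -
    define q where "q = l2_inner \<Omega> (weighted \<eta> w) w"
    have w': "w \<in> HL \<Omega>" "w \<in> L2 \<Omega>" using w by (auto simp: HLn_def intro: HL_L2)
    have "q \<ge> 0" unfolding q_def by (rule weighted_inner_self_nonneg[OF w'(2) \<eta>])
    show ?thesis
    proof (cases "q = 0")
      case True
      have "c * (l2_norm \<Omega> w)\<^sup>2 \<le> 0"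
        using weighted_coercive[OF w'(2) \<eta> c(4)] True by (simp add: q_def)
      then have "l2_norm \<Omega> w = 0" using c(1) by (simp add: mult_le_0_iff)
      then show ?thesis
        using l2_Cauchy_Schwarz[OF A[OF w'(2)] w'(2)] True by (simp add: q_def)
    next
      case False
      with \<open>q \<ge> 0\<close> have "q > 0" by simp
      define s where "s = 1 / sqrt q"
      have s: "s * s * q = 1" using \<open>q > 0\<close> by (simp add: s_def)
      let ?u = "\<lambda>x. s *\<^sub>R w x"
      have "?u \<in> HLn \<Omega> \<eta> j n"
        using w by (simp add: HLn_def HL_scaleR l2_inner_scaleR_left)
      moreover have "eta_norm \<Omega> \<eta> ?u = 1"
        using s by (simp add: eta_norm_def weighted_inner_scaleR_left l2_inner_scaleR_right q_def[symmetric])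
      ultimately have "l2_inner \<Omega> (A_op \<mu>\<^sub>0 \<Omega> ?u) ?u \<le> l2_inner \<Omega> (A_op \<mu>\<^sub>0 \<Omega> (j n)) (j n)"
        using max[OF n] by (auto simp: is_arg_max_def not_less)
      also have "\<dots> \<le> \<tau> n" by (rule \<tau>[OF n])
      finally have "s * s * l2_inner \<Omega> (A_op \<mu>\<^sub>0 \<Omega> w) w \<le> \<tau> n"
        using l2_inner_scaleR_left[of \<Omega> s "A_op \<mu>\<^sub>0 \<Omega> w" w]
        by (simp add: A_op_scaleR[abs_def] l2_inner_scaleR_right)
      then have "q * (s * s * l2_inner \<Omega> (A_op \<mu>\<^sub>0 \<Omega> w) w) \<le> q * \<tau> n"
        using \<open>q \<ge> 0\<close> by (intro mult_left_mono)
      also have "q * (s * s * l2_inner \<Omega> (A_op \<mu>\<^sub>0 \<Omega> w) w) = s * s * q * l2_inner \<Omega> (A_op \<mu>\<^sub>0 \<Omega> w) w"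
        by (simp add: mult_ac)
      finally show ?thesis using s by (simp add: q_def mult.commute)
    qed
  qed
  have conv: "(\<lambda>N. l2_norm \<Omega> (residual v N)) \<longlonglongrightarrow> 0" if v: "v \<in> HL \<Omega>" for v
  proof (rule residual_limit_zero[OF \<open>\<mu>\<^sub>0 > 0\<close> HL_L2[OF v]])
    let ?W = "l2_inner \<Omega> (weighted \<eta> v) v"
    fix N
    have "residual v N \<in> HL \<Omega>"
      unfolding residual_def by (intro HL_diff HL_sum HL_scaleR HL \<Omega> v) auto
    \<comment> \<open>Membership in the space of index \<open>Suc N\<close> asks for orthogonality
      to exactly the first \<open>N\<close> maximizers, the ones removed from
      \<open>v\<close>.\<close>
    moreover have "l2_inner \<Omega> (residual v N) (weighted \<eta> (j k)) = 0" if "k \<in> {1..<Suc N}" for k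
      using fourier_residual[OF HL_L2[OF v], of k N] that by (simp add: weighted_inner_move fourier_def)
    ultimately have "residual v N \<in> HLn \<Omega> \<eta> j (Suc N)" by (simp add: HLn_def)
    then have "l2_inner \<Omega> (A_op \<mu>\<^sub>0 \<Omega> (residual v N)) (residual v N)
        \<le> \<tau> (Suc N) * l2_inner \<Omega> (weighted \<eta> (residual v N)) (residual v N)"
      by (intro energy) auto
    \<comment> \<open>By \<open>norm_residual\<close> the residual has weighted norm at most that of
      \<open>v\<close>, so one constant serves for all \<open>N\<close>.\<close>
    also have "\<dots> \<le> \<tau> (Suc N) * ?W"
      unfolding norm_residual[OF HL_L2[OF v]] by (intro mult_left_mono \<tau>_nonneg) (simp add: sum_nonneg)
    finally show "l2_inner \<Omega> (A_op \<mu>\<^sub>0 \<Omega> (residual v N)) (residual v N) \<le> \<tau> (Suc N) * ?W" .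
  next
    show "(\<lambda>N. \<tau> (Suc N) * l2_inner \<Omega> (weighted \<eta> v) v) \<longlonglongrightarrow> 0"
      using tendsto_mult_right[OF LIMSEQ_Suc[OF \<open>\<tau> \<longlonglongrightarrow> 0\<close>], of "l2_inner \<Omega> (weighted \<eta> v) v"] by simp
  qed
  \<comment> \<open>The density clause follows by taking the Fourier coefficients of
    \<open>v\<close> as coefficients.\<close>
  have "\<exists>N a. l2_norm \<Omega> (\<lambda>x. v x - (\<Sum>k=1..N. a k *\<^sub>R j k x)) < \<epsilon>" if v: "v \<in> HL \<Omega>" and \<epsilon>: "\<epsilon> > 0" for v \<epsilon>
  proof -
    obtain N where "norm (l2_norm \<Omega> (residual v N) - 0) < \<epsilon>"
      using LIMSEQ_D[OF conv[OF v] \<epsilon>] by blast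
    then have "l2_norm \<Omega> (residual v N) < \<epsilon>" by simp
    then show ?thesis unfolding residual_def by blast
  qed
  then show ?thesis
    unfolding complete_basis_HL_def
    using HL orthonormal conv by (simp add: residual_def fourier_def)
qed

end
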